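(* If $c=c^*$, then there exists a nontrivial (i.e. nonconstant) positive function $\phi\in C^2(\mathbb{R},\mathbb{R})$ satisfying $$\phi''(\xi)-c\,\phi'(\xi)-d\,\phi(\xi)+b\big(\phi(\xi-c\,\tau(\phi(\xi)))\big)=0,\qquad \xi\in\mathbb{R},$$ together with $$k\le\liminf_{\xi\to+\infty}\phi(\xi)\le\limsup_{\xi\to+\infty}\phi(\xi)\le\mathcal{K}.$$
   Context: Setting. $d>0$ is a constant. The birth function $b:[0,\infty)\to[0,\infty)$ satisfies, for some constant $K>0$: $b(0)=0$, $b(K)=dK$, $b(u)>du$ for $u\in(0,K)$, and $0<b(u)<du$ for $u>K$. The delay function $\tau:[0,\infty)\to[0,\infty)$ is $C^1$ on $[0,\infty)$, satisfies $0\le\tau'(u)<1$ for all $u\ge 0$, and $0\le m:=\tau(0)\le\lim_{u\to\infty}\tau(u)=:M<\infty$. Further assumptions ($b$ need not be monotone): $b$ is $C^1$ on $[0,\infty)$; $b'(0)>d$ and $b(u)<b'(0)u$ for $u\in(0,\infty)$; $|b'(u)|\le b'(0)$ for $u\in[0,K]$; and there is $L>0$ such that $0\le b'(0)u-b(u)<Lu^2$ for $u\in(0,K]$. Notation: $\mathcal{K}=\frac1d\max_{u\in[0,K]}b(u)$, so that $K\le\mathcal{K}$. For $u\in[0,\mathcal{K}]$ let $\underline{b}(u)=\min_{v\in[u,\mathcal{K}]}b(v)$. The constant $k$ satisfies $0<k\le K\le\mathcal{K}$ and $\underline{b}(k)=dk$ (such $k$ exists). Definition of $c^*$. For $\lambda\ge0$,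 $c\ge0$ let $\Lambda(\lambda,c)=\lambda^2-c\lambda-d+b'(0)e^{-\lambda c m}$. Then $c^*>0$ is the constant such that $\Lambda(\lambda,c)>0$ for all $\lambda\ge0$ if $c\in[0,c^* )$, while for $c>c^*$ the equation $\Lambda(\lambda,c)=0$ has exactly two distinct positive real roots $\lambda_1(c)<\lambda_2(c)$, with $\Lambda(\cdot,c)<0$ on $(\lambda_1(c),\lambda_2(c))$ and $\Lambda(\cdot,c)>0$ on $[0,\lambda_1(c))\cup(\lambda_2(c),\infty)$. *)

theory Defs
  imports "HOL-Analysis.Analysis"
begin

(* The maximum over the compact interval is written as Sup, since Max is only meaningful for
   finite sets; for continuous b the supremum is attained. Likewise for the minimum below. *)
definition calK :: "real \<Rightarrow> (real \<Rightarrow> real) \<Rightarrow> real \<Rightarrow> real" where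
  "calK d b K = (1 / d) * (SUP u\<in>{0..K}. b u)"

definition b_low :: "real \<Rightarrow> (real \<Rightarrow> real) \<Rightarrow> real \<Rightarrow> real \<Rightarrow> real" where
  "b_low d b K u = (INF v\<in>{u..calK d b K}. b v)"

(* p stands for b'(0). *)
definition Lam :: "real \<Rightarrow> real \<Rightarrow> real \<Rightarrow> real \<Rightarrow> real \<Rightarrow> real" where
  "Lam d p m l c = l\<^sup>2 - c * l - d + p * exp (- (l * c * m))"

(* These conditions determine cs uniquely. *)
definition is_critical_speed :: "real \<Rightarrow> real \<Rightarrow> real \<Rightarrow> real \<Rightarrow> bool" where
  "is_critical_speed d p m cs \<longleftrightarrow>
     cs > 0 \<and>
     (\<forall>c\<in>{0..<cs}. \<forall>l\<ge>0. Lam d p m l c > 0) \<and>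
     (\<forall>c>cs. \<exists>l1 l2. 0 < l1 \<and> l1 < l2 \<and>
        {l. 0 < l \<and> Lam d p m l c = 0} = {l1, l2} \<and>
        (\<forall>l\<in>{l1<..<l2}. Lam d p m l c < 0) \<and>
        (\<forall>l\<in>{0..<l1} \<union> {l2<..}. Lam d p m l c > 0))"

end

theory Submission
  imports Defs "HOL-Probability.Distributions" "HOL-Complex_Analysis.Great_Picard"
begin

text \<open>
  With \<open>- \<alpha> < 0 < \<beta>\<close> the roots of \<open>r\<^sup>2 - c r - d\<close>, bounded solutions of the profile equation are the
  fixed points of \<open>\<phi> = G (b (\<phi> (\<cdot> - c \<tau> (\<phi>))))\<close>, where \<open>G\<close> is convolution with the (positive) Green
  function.  At the critical speed \<open>\<Lambda> (l, c) \<le> 0\<close> for some \<open>l > 0\<close>, so that \<open>exp (l x)\<close> is a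
  supersolution.

  No subsolution is constructed.  Instead the nonlinearity is replaced by its maximum with a
  small source \<open>\<delta> exp (l min (s, 0))\<close>.  A Schauder argument gives a fixed point
  \<open>\<phi>\<^sub>\<delta> \<le> min (\<K>, exp (l x))\<close>; the source makes it bounded away from zero near \<open>+\<infinity>\<close>, and then
  \<open>liminf \<phi>\<^sub>\<delta> \<ge> k\<close>, because the limes inferior \<open>I\<close> satisfies \<open>d I \<ge> min b\<close> over \<open>[I, \<K>]\<close>.
  As \<open>\<phi>\<^sub>\<delta>\<close> vanishes at \<open>- \<infinity>\<close>, it crosses the level \<open>k / 2\<close> a last time; translate this crossing to
  the origin and let \<open>\<delta> \<rightarrow> 0\<close>.  The source disappears uniformly, wherever it has been translated to,
  and the limit is a solution with \<open>\<phi> 0 = k / 2\<close> and \<open>\<phi> \<ge> k / 2\<close> on \<open>[0, \<infinity>)\<close>.  It is not constant,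
  since the only constant solution in \<open>(0, K]\<close> is \<open>K\<close>, and again \<open>liminf \<phi> \<ge> k\<close>.
\<close>

section \<open>Exponential averages\<close>

text \<open>The mean of \<open>f (x - T)\<close> for \<open>T\<close> exponentially distributed with
  rate \<open>r\<close>; the density vanishes for negative \<open>t\<close>, so only values of
  \<open>f\<close> to the left of \<open>x\<close> enter.\<close>

definition exp_avg :: "real \<Rightarrow> (real \<Rightarrow> real) \<Rightarrow> real \<Rightarrow> real" where
  "exp_avg r f x = (\<integral>t. exponential_density r t * f (x - t) \<partial>lborel)"

lemma exponential_density_measurable [measurable]:
  "(\<lambda>t. exponential_density r t) \<in> borel_measurable borel"
  unfolding exponential_density_def by measurable

lemma has_integral_exponential_density:
  assumes "r > 0"
  shows "has_bochner_integral lborel (exponential_density r) 1"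
proof (rule has_bochner_integral_nn_integral)
  interpret prob_space "density lborel (exponential_density r)"
    by (rule prob_space_exponential_density[OF assms])
  show "(\<integral>\<^sup>+ x. ennreal (exponential_density r x) \<partial>lborel) = ennreal 1"
    using emeasure_space_1 by (simp add: emeasure_density)
qed (use assms in \<open>auto simp: exponential_density_nonneg\<close>)

lemma exp_avg_integrable:
  assumes "r > 0" and [measurable]: "f \<in> borel_measurable borel" and "\<And>s. \<bar>f s\<bar> \<le> B"
  shows "integrable lborel (\<lambda>t. exponential_density r t * f (x - t))"
proof (rule Bochner_Integration.integrable_bound)
  show "integrable lborel (\<lambda>t. exponential_density r t * B)"
    using has_integral_exponential_density[OF assms(1)]
    by (auto simp: has_bochner_integral_iff)
  have "\<bar>f (x - t)\<bar> \<le> \<bar>B\<bar>" for t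
    using assms(3)[of "x - t"] by linarith
  then show "AE t in lborel. norm (exponential_density r t * f (x - t))
      \<le> norm (exponential_density r t * B)"
    by (auto simp: abs_mult intro!: mult_left_mono)
qed measurable

text \<open>Exponential tilting: the integrand is a multiple of the density of rate
  \<open>r + l\<close>, which requires \<open>l > - r\<close>.\<close>

lemma has_integral_exp_avg_exp:
  assumes "r > 0" "l > - r"
  shows "has_bochner_integral lborel (\<lambda>t. exponential_density r t * exp (l * (x - t)))
    (r / (r + l) * exp (l * x))"
proof -
  have "exponential_density r t * exp (l * (x - t))
      = (r / (r + l) * exp (l * x)) * exponential_density (r + l) t" for t
    using assms by (auto simp: exponential_density_def exp_add exp_diff exp_minus field_simps)
  then show ?thesis
    using has_bochner_integral_mult_right[OF has_integral_exponential_density[of "r + l"],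
        of "r / (r + l) * exp (l * x)"] assms by simp
qed

lemma exp_avg_const: "r > 0 \<Longrightarrow> exp_avg r (\<lambda>_. B) x = B"
  using has_integral_exponential_density[of r] by (simp add: exp_avg_def has_bochner_integral_iff)

text \<open>Integrability is assumed instead of boundedness because the comparison functions include
  unbounded exponentials.\<close>

lemma exp_avg_mono:
  assumes "r > 0"
    and "integrable lborel (\<lambda>t. exponential_density r t * f (x - t))"
    and "integrable lborel (\<lambda>t. exponential_density r t * g (x - t))"
    and "\<And>s. s \<le> x \<Longrightarrow> f s \<le> g s"
  shows "exp_avg r f x \<le> exp_avg r g x"
  unfolding exp_avg_def using assms
  by (intro integral_mono) (auto simp: exponential_density_def)

lemma exp_avg_nonneg: "r > 0 \<Longrightarrow> (\<And>s. f s \<ge> 0) \<Longrightarrow> exp_avg r f x \<ge> 0"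
  unfolding exp_avg_def
  by (intro Bochner_Integration.integral_nonneg) (auto intro!: mult_nonneg_nonneg exponential_density_nonneg)

lemma exp_avg_shift: "exp_avg r (\<lambda>s. f (s + h)) x = exp_avg r f (x + h)"
  by (simp add: exp_avg_def algebra_simps)

lemma exp_avg_diff:
  assumes "r > 0" "f \<in> borel_measurable borel" "g \<in> borel_measurable borel"
    and "\<And>s. \<bar>f s\<bar> \<le> B" "\<And>s. \<bar>g s\<bar> \<le> B"
  shows "exp_avg r (\<lambda>s. f s - g s) x = exp_avg r f x - exp_avg r g x"
  unfolding exp_avg_def right_diff_distrib
  using assms by (intro Bochner_Integration.integral_diff exp_avg_integrable) auto

lemma exp_avg_dist:
  assumes "r > 0" and [measurable]: "f \<in> borel_measurable borel" "g \<in> borel_measurable borel"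
    and "\<And>s. \<bar>f s\<bar> \<le> B" "\<And>s. \<bar>g s\<bar> \<le> B" "\<And>s. \<bar>f s - g s\<bar> \<le> e"
  shows "\<bar>exp_avg r f x - exp_avg r g x\<bar> \<le> e"
proof -
  have i: "integrable lborel (\<lambda>t. exponential_density r t * (f (x - t) - g (x - t)))"
    by (rule exp_avg_integrable[OF assms(1) _ assms(6)]) simp
  have c: "integrable lborel (\<lambda>t. exponential_density r t * a)" for a :: real
    using has_integral_exponential_density[OF assms(1)] by (auto simp: has_bochner_integral_iff)
  have "f s - g s \<le> e" "- e \<le> f s - g s" for s
    using assms(6)[of s] by linarith+
  then have "exp_avg r (\<lambda>s. f s - g s) x \<le> exp_avg r (\<lambda>_. e) x"
    "exp_avg r (\<lambda>_. - e) x \<le> exp_avg r (\<lambda>s. f s - g s) x"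
    by (intro exp_avg_mono[OF assms(1)] i c; simp)+
  then show ?thesis
    using assms exp_avg_diff[OF assms(1-5)] by (simp add: exp_avg_const abs_le_iff)
qed

lemma exp_avg_tendsto:
  assumes "r > 0" and [measurable]: "\<And>n. f n \<in> borel_measurable borel" "g \<in> borel_measurable borel"
    and "\<And>n s. \<bar>f n s\<bar> \<le> B" and lim: "\<And>s. (\<lambda>n. f n s) \<longlonglongrightarrow> g s"
  shows "(\<lambda>n. exp_avg r (f n) x) \<longlonglongrightarrow> exp_avg r g x"
  unfolding exp_avg_def
proof (rule integral_dominated_convergence)
  show "integrable lborel (\<lambda>t. exponential_density r t * B)"
    using has_integral_exponential_density[OF assms(1)] by (auto simp: has_bochner_integral_iff)
  show "AE t in lborel. (\<lambda>n. exponential_density r t * f n (x - t))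
      \<longlonglongrightarrow> exponential_density r t * g (x - t)"
    using lim by (auto intro!: tendsto_intros)
  show "AE t in lborel. norm (exponential_density r t * f n (x - t)) \<le> exponential_density r t * B" for n
    using assms exponential_density_nonneg[OF assms(1)]
    by (auto simp: abs_mult intro!: mult_left_mono)
qed measurable

text \<open>The substitution \<open>s = x - t\<close> moves the dependence on \<open>x\<close> from
  the integrand into the domain of integration. Increments, monotonicity and the derivative of the
  average are read off from this form.\<close>

lemma exp_avg_eq_set_integral:
  "exp (r * x) * exp_avg r f x = (LINT s:{..x}|lborel. r * exp (r * s) * f s)"
proof -
  have "exp (r * x) * exp_avg r f x
      = (\<integral>t. exp (r * x) * (exponential_density r t * f (x - t)) \<partial>lborel)"
    by (simp add: exp_avg_def)
  also have "\<dots> = \<bar>-1\<bar> *\<^sub>R (\<integral>t. indicator {..x} (x + (-1) * t) *\<^sub>R (r * exp (r * (x + (-1) * t)) * f (x + (-1) * t)) \<partial>lborel)"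
    unfolding abs_minus_cancel abs_one scaleR_one
    by (rule Bochner_Integration.integral_cong)
       (auto simp: exponential_density_def exp_diff exp_minus indicator_def field_simps)
  also have "\<dots> = (LINT s:{..x}|lborel. r * exp (r * s) * f s)"
    unfolding set_lebesgue_integral_def
    by (rule lborel_integral_real_affine[symmetric]) simp
  finally show ?thesis .
qed

lemma set_integrable_exp_weight:
  fixes r :: real
  assumes "r > 0" and [measurable]: "f \<in> borel_measurable borel" and "\<And>s. \<bar>f s\<bar> \<le> B"
  shows "set_integrable lborel {..x} (\<lambda>s. r * exp (r * s) * f s)"
proof -
  have "integrable lborel (\<lambda>t. exp (r * x) * (exponential_density r t * f (x - t)))"
    by (intro integrable_mult_right exp_avg_integrable[OF assms])
  also have "(\<lambda>t. exp (r * x) * (exponential_density r t * f (x - t)))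
      = (\<lambda>t. indicator {..x} (x + (-1) * t) *\<^sub>R (r * exp (r * (x + (-1) * t)) * f (x + (-1) * t)))"
    by (rule ext) (auto simp: exponential_density_def exp_diff exp_minus indicator_def field_simps)
  finally show ?thesis
    unfolding set_integrable_def by (subst (asm) lborel_integrable_real_affine_iff) simp_all
qed

lemma exp_avg_increment:
  assumes "r > 0" "f \<in> borel_measurable borel" "\<And>s. \<bar>f s\<bar> \<le> B" "x \<le> y"
  shows "exp (r * y) * exp_avg r f y - exp (r * x) * exp_avg r f x
    = (LINT s:{x<..y}|lborel. r * exp (r * s) * f s)"
    and "set_integrable lborel {x<..y} (\<lambda>s. r * exp (r * s) * f s)"
proof -
  have *: "set_integrable lborel {x<..y} (\<lambda>s. r * exp (r * s) * f s)"
    by (rule set_integrable_subset[OF set_integrable_exp_weight[OF assms(1-3), of y]]) auto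
  show "set_integrable lborel {x<..y} (\<lambda>s. r * exp (r * s) * f s)" by (fact *)
  have "(LINT s:{..x} \<union> {x<..y}|lborel. r * exp (r * s) * f s)
     = (LINT s:{..x}|lborel. r * exp (r * s) * f s) + (LINT s:{x<..y}|lborel. r * exp (r * s) * f s)"
    by (intro set_integral_Un set_integrable_exp_weight[OF assms(1-3)] *) auto
  moreover have "{..x} \<union> {x<..y} = {..y}" using assms by auto
  ultimately show "exp (r * y) * exp_avg r f y - exp (r * x) * exp_avg r f x
    = (LINT s:{x<..y}|lborel. r * exp (r * s) * f s)"
    by (simp add: exp_avg_eq_set_integral)
qed

text \<open>The average is \<open>exp (- r x)\<close> times an integral over \<open>{..x}\<close>.
  The new piece of the integral and the change of the weight each contribute at most
  \<open>B (1 - exp (- r (y - x)))\<close>, which is at most \<open>r B (y - x)\<close>; hence the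
  factor 2.\<close>

lemma exp_avg_lipschitz_le:
  assumes "r > 0" "f \<in> borel_measurable borel" "\<And>s. \<bar>f s\<bar> \<le> B" "x \<le> y"
  shows "\<bar>exp_avg r f y - exp_avg r f x\<bar> \<le> 2 * r * B * (y - x)"
proof -
  have B: "B \<ge> 0" using assms(3)[of 0] by linarith
  have lb: "- B \<le> f s" for s using assms(3)[of s] by linarith
  have wl: "r * exp (r * s) * (- B) \<le> r * exp (r * s) * f s" for s
    using assms(1) by (intro mult_left_mono lb) simp
  have inc: "\<bar>exp (r * y) * exp_avg r f y - exp (r * x) * exp_avg r f x\<bar>
      \<le> B * (exp (r * y) - exp (r * x))"
  proof -
    have "(LINT s:{x<..y}|lborel. r * exp (r * s) * f s) \<le> (LINT s:{x<..y}|lborel. r * exp (r * s) * B)"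
      using assms abs_le_D1[OF assms(3)]
      by (intro set_integral_mono exp_avg_increment(2)[where B = B]) (auto simp: B)
    moreover have "(LINT s:{x<..y}|lborel. r * exp (r * s) * (- B)) \<le> (LINT s:{x<..y}|lborel. r * exp (r * s) * f s)"
      using assms(4) by (intro set_integral_mono exp_avg_increment(2)[where B = B] wl assms) (auto simp: B)
    ultimately show ?thesis
      using exp_avg_increment(1)[OF assms]
        exp_avg_increment(1)[OF assms(1), of "\<lambda>_. B" B x y]
        exp_avg_increment(1)[OF assms(1), of "\<lambda>_. - B" B x y] assms(1,4)
      by (simp add: exp_avg_const B abs_le_iff algebra_simps)
  qed
  have avg: "\<bar>exp_avg r f x\<bar> \<le> B"
    using exp_avg_dist[OF assms(1,2), of "\<lambda>_. 0" B B x] assms(3) exp_avg_const[OF assms(1), of 0] B by simp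
  have eq: "exp_avg r f y - exp_avg r f x
     = exp (- (r * y)) * (exp (r * y) * exp_avg r f y - exp (r * x) * exp_avg r f x)
       - (1 - exp (- (r * (y - x)))) * exp_avg r f x"
    by (simp add: algebra_simps exp_add[symmetric] exp_minus[symmetric] flip: mult.assoc)
  have e: "0 \<le> 1 - exp (- (r * (y - x)))" "1 - exp (- (r * (y - x))) \<le> r * (y - x)"
    using assms exp_ge_add_one_self[of "- (r * (y - x))"] by auto
  have "\<bar>exp_avg r f y - exp_avg r f x\<bar>
     \<le> exp (- (r * y)) * \<bar>exp (r * y) * exp_avg r f y - exp (r * x) * exp_avg r f x\<bar>
       + (1 - exp (- (r * (y - x)))) * \<bar>exp_avg r f x\<bar>"
    unfolding eq using e(1) by (simp add: abs_mult order.trans[OF abs_triangle_ineq4])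
  also have "\<dots> \<le> exp (- (r * y)) * (B * (exp (r * y) - exp (r * x))) + (1 - exp (- (r * (y - x)))) * B"
    using inc avg e(1) by (intro add_mono mult_left_mono) auto
  also have "exp (- (r * y)) * (B * (exp (r * y) - exp (r * x))) = (1 - exp (- (r * (y - x)))) * B"
    by (simp add: algebra_simps exp_add[symmetric] flip: mult.assoc)
  also have "(1 - exp (- (r * (y - x)))) * B + (1 - exp (- (r * (y - x)))) * B \<le> 2 * r * B * (y - x)"
    using mult_right_mono[OF e(2) B] by (simp add: algebra_simps)
  finally show ?thesis .
qed

lemma exp_avg_lipschitz:
  assumes "r > 0" "f \<in> borel_measurable borel" "\<And>s. \<bar>f s\<bar> \<le> B"
  shows "\<bar>exp_avg r f x - exp_avg r f y\<bar> \<le> 2 * r * B * \<bar>x - y\<bar>"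
  using exp_avg_lipschitz_le[OF assms, of x y] exp_avg_lipschitz_le[OF assms, of y x]
  by (cases x y rule: linorder_le_cases) (auto simp: abs_minus_commute)

text \<open>For nonnegative \<open>f\<close> the weighted integral grows with its domain, so
  positivity at one point passes to every later one.\<close>

lemma exp_avg_decay:
  assumes "r > 0" "f \<in> borel_measurable borel" "\<And>s. 0 \<le> f s" "\<And>s. f s \<le> B" "x \<le> y"
  shows "exp (r * x) * exp_avg r f x \<le> exp (r * y) * exp_avg r f y"
proof -
  have "0 \<le> (LINT s:{x<..y}|lborel. r * exp (r * s) * f s)"
    unfolding set_lebesgue_integral_def using assms by (intro Bochner_Integration.integral_nonneg) auto
  then show ?thesis
    using exp_avg_increment(1)[OF assms(1,2), of B x y] assms by simp
qed

lemma exp_avg_deriv: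
  assumes r: "r > 0" and f: "continuous_on UNIV f" and B: "\<And>s. \<bar>f s\<bar> \<le> B"
  shows "(exp_avg r f has_real_derivative r * (f x - exp_avg r f x)) (at x)"
proof -
  have m: "f \<in> borel_measurable borel" by (rule borel_measurable_continuous_onI[OF f])
  \<comment> \<open>The base point \<open>x - 1\<close> is arbitrary; it replaces the half-line by a
    compact interval, where the fundamental theorem of calculus applies, and leaves a
    constant.\<close>
  define H where "H = (\<lambda>y. integral {x - 1..y} (\<lambda>s. r * exp (r * s) * f s))"
  have H: "exp (r * y) * exp_avg r f y = exp (r * (x - 1)) * exp_avg r f (x - 1) + H y"
    if "y \<in> {x - 1<..<x + 1}" for y
  proof -
    have "(LINT s:{x - 1<..y}|lborel. r * exp (r * s) * f s) = integral {x - 1<..y} (\<lambda>s. r * exp (r * s) * f s)"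
      using that by (intro set_borel_integral_eq_integral(2) exp_avg_increment(2)[OF r m B]) auto
    also have "\<dots> = H y"
      unfolding H_def using that
      by (intro integral_subset_negligible negligible_subset[OF negligible_sing[of "x - 1"]]) auto
    finally show ?thesis using exp_avg_increment(1)[OF r m B, of "x - 1" y] that by simp
  qed
  have "(H has_real_derivative r * exp (r * x) * f x) (at x within {x - 1..x + 1})"
    unfolding H_def
    by (rule integral_has_real_derivative)
       (auto intro!: continuous_intros continuous_on_subset[OF f])
  then have "(H has_real_derivative r * exp (r * x) * f x) (at x)"
    by (subst (asm) at_within_interior) (auto simp: interior_atLeastAtMost_real)
  then have "((\<lambda>y. exp (- (r * y)) * (exp (r * (x - 1)) * exp_avg r f (x - 1) + H y))
      has_real_derivative (- r) * exp (- (r * x)) * (exp (r * (x - 1)) * exp_avg r f (x - 1) + H x)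
        + exp (- (r * x)) * (r * exp (r * x) * f x)) (at x)"
    by (auto intro!: derivative_eq_intros)
  moreover have "(- r) * exp (- (r * x)) * (exp (r * (x - 1)) * exp_avg r f (x - 1) + H x)
        + exp (- (r * x)) * (r * exp (r * x) * f x) = r * (f x - exp_avg r f x)"
    by (subst H[symmetric]) (auto simp: algebra_simps exp_minus)
  ultimately have "((\<lambda>y. exp (- (r * y)) * (exp (r * (x - 1)) * exp_avg r f (x - 1) + H y))
      has_real_derivative r * (f x - exp_avg r f x)) (at x)" by simp
  then show ?thesis
  proof (rule has_field_derivative_transform_within_open[where S = "{x - 1<..<x + 1}"])
    fix y assume "y \<in> {x - 1<..<x + 1}"
    then show "exp (- (r * y)) * (exp (r * (x - 1)) * exp_avg r f (x - 1) + H y) = exp_avg r f y"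
      by (subst H[symmetric]) (auto simp: exp_minus)
  qed auto
qed

section \<open>The Green operator\<close>

locale green_operator =
  fixes \<alpha> \<beta> :: real
  assumes \<alpha>: "\<alpha> > 0" and \<beta>: "\<beta> > 0"
begin

text \<open>Convolution with the Green function of
  \<open>- u'' + (\<beta> - \<alpha>) u' + \<alpha> \<beta> u\<close>, which is
  \<open>exp (- \<alpha> t) / (\<alpha> + \<beta>)\<close> for \<open>t \<ge> 0\<close> and
  \<open>exp (\<beta> t) / (\<alpha> + \<beta>)\<close> for \<open>t \<le> 0\<close>. The reflected
  average covers the values of \<open>f\<close> to the right of \<open>x\<close>.\<close>

definition G :: "(real \<Rightarrow> real) \<Rightarrow> real \<Rightarrow> real" where
  "G f x = (exp_avg \<alpha> f x / \<alpha> + exp_avg \<beta> (\<lambda>s. f (- s)) (- x) / \<beta>) / (\<alpha> + \<beta>)"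

text \<open>\<open>G\<close> is positive, divides constants by \<open>\<alpha> * \<beta>\<close> and
  divides \<open>exp (l * x)\<close> by \<open>(\<alpha> + l) * (\<beta> - l)\<close>, the negative
  of the characteristic polynomial at \<open>l\<close>. The cases \<open>C = 0\<close> and
  \<open>a = 0\<close> give the constant bound and the supersolution; negation gives the lower bound
  used near \<open>+\<infinity>\<close>.\<close>

lemma G_le_exp:
  assumes [measurable]: "f \<in> borel_measurable borel" and "\<And>s. \<bar>f s\<bar> \<le> B"
    and le: "\<And>s. f s \<le> a + C * exp (l * s)" and l: "- \<alpha> < l" "l < \<beta>"
  shows "G f x \<le> a / (\<alpha> * \<beta>) + C * exp (l * x) / ((\<alpha> + l) * (\<beta> - l))"
proof -
  have int: "has_bochner_integral lborel
      (\<lambda>t. exponential_density r t * (a + C * exp (k * (y - t))))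
      (a + C * (r / (r + k) * exp (k * y)))" if "r > 0" "k > - r" for r k y
  proof -
    have "has_bochner_integral lborel
        (\<lambda>t. exponential_density r t * a + C * (exponential_density r t * exp (k * (y - t))))
        (1 * a + C * (r / (r + k) * exp (k * y)))"
      using that by (intro has_bochner_integral_add has_bochner_integral_mult_right
        has_bochner_integral_mult_left has_integral_exp_avg_exp has_integral_exponential_density) auto
    moreover have "(\<lambda>t. exponential_density r t * (a + C * exp (k * (y - t))))
        = (\<lambda>t. exponential_density r t * a + C * (exponential_density r t * exp (k * (y - t))))"
      by (simp add: fun_eq_iff distrib_left)
    ultimately show ?thesis by (simp only: mult_1)
  qed
  have "exp_avg \<alpha> f x \<le> exp_avg \<alpha> (\<lambda>s. a + C * exp (l * s)) x"
    using \<alpha> int[of \<alpha> l x] l assms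
    by (intro exp_avg_mono exp_avg_integrable[OF \<alpha> assms(1,2)]) (auto simp: has_bochner_integral_iff)
  also have "\<dots> = a + C * (\<alpha> / (\<alpha> + l) * exp (l * x))"
    unfolding exp_avg_def using int[of \<alpha> l x] l \<alpha> by (simp add: has_bochner_integral_integral_eq)
  finally have 1: "exp_avg \<alpha> f x \<le> a + C * (\<alpha> / (\<alpha> + l) * exp (l * x))" .
  have "exp_avg \<beta> (\<lambda>s. f (- s)) (- x) \<le> exp_avg \<beta> (\<lambda>s. a + C * exp (- l * s)) (- x)"
    using \<beta> int[of \<beta> "- l" "- x"] l assms(2) le[of "- s" for s]
    by (intro exp_avg_mono exp_avg_integrable[OF \<beta> _ assms(2)]) (auto simp: has_bochner_integral_iff)
  also have "\<dots> = a + C * (\<beta> / (\<beta> + - l) * exp (- l * - x))"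
    unfolding exp_avg_def using int[of \<beta> "- l" "- x"] l \<beta> by (simp add: has_bochner_integral_integral_eq)
  finally have 2: "exp_avg \<beta> (\<lambda>s. f (- s)) (- x) \<le> a + C * (\<beta> / (\<beta> - l) * exp (l * x))" by simp
  have "G f x \<le> ((a + C * (\<alpha> / (\<alpha> + l) * exp (l * x))) / \<alpha> + (a + C * (\<beta> / (\<beta> - l) * exp (l * x))) / \<beta>) / (\<alpha> + \<beta>)"
    unfolding G_def using 1 2 \<alpha> \<beta> by (intro divide_right_mono add_mono) auto
  also have "\<dots> = a * ((1 / \<alpha> + 1 / \<beta>) / (\<alpha> + \<beta>)) + C * exp (l * x) * ((1 / (\<alpha> + l) + 1 / (\<beta> - l)) / (\<alpha> + \<beta>))"
    using \<alpha> \<beta> by (simp add: add_divide_distrib distrib_left) 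
  also have "(1 / \<alpha> + 1 / \<beta>) / (\<alpha> + \<beta>) = 1 / (\<alpha> * \<beta>)"
    using \<alpha> \<beta> by (simp add: divide_simps)
  also have "(1 / (\<alpha> + l) + 1 / (\<beta> - l)) / (\<alpha> + \<beta>) = 1 / ((\<alpha> + l) * (\<beta> - l))"
    using \<alpha> \<beta> l by (simp add: divide_simps)
  finally show ?thesis by simp
qed

lemma G_uminus: "G (\<lambda>s. - f s) x = - G f x"
  unfolding G_def exp_avg_def using \<alpha> \<beta> by (simp add: divide_simps)

lemma G_ge_exp:
  assumes "f \<in> borel_measurable borel" and "\<And>s. \<bar>f s\<bar> \<le> B"
    and le: "\<And>s. f s \<ge> a - C * exp (l * s)" and l: "- \<alpha> < l" "l < \<beta>"
  shows "G f x \<ge> a / (\<alpha> * \<beta>) - C * exp (l * x) / ((\<alpha> + l) * (\<beta> - l))"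
proof -
  have "- f s \<le> - a + C * exp (l * s)" for s
    using le[of s] by linarith
  then have "G (\<lambda>s. - f s) x \<le> - a / (\<alpha> * \<beta>) + C * exp (l * x) / ((\<alpha> + l) * (\<beta> - l))"
    using assms by (intro G_le_exp[where B = B]) auto
  then show ?thesis by (simp add: G_uminus)
qed

lemma G_le_const:
  assumes "f \<in> borel_measurable borel" and "\<And>s. 0 \<le> f s" "\<And>s. f s \<le> B"
  shows "G f x \<le> B / (\<alpha> * \<beta>)"
  using G_le_exp[of f B B 0 0 x] assms \<alpha> \<beta> by auto

lemma G_nonneg: "(\<And>s. f s \<ge> 0) \<Longrightarrow> G f x \<ge> 0"
  unfolding G_def using \<alpha> \<beta> by (auto intro!: divide_nonneg_pos add_nonneg_nonneg exp_avg_nonneg)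

lemma G_dist:
  assumes [measurable]: "f \<in> borel_measurable borel" "g \<in> borel_measurable borel"
    and "\<And>s. \<bar>f s\<bar> \<le> B" "\<And>s. \<bar>g s\<bar> \<le> B" "\<And>s. \<bar>f s - g s\<bar> \<le> e"
  shows "\<bar>G f x - G g x\<bar> \<le> e / (\<alpha> * \<beta>)"
proof -
  have 1: "\<bar>exp_avg \<alpha> f x - exp_avg \<alpha> g x\<bar> \<le> e"
    by (rule exp_avg_dist[OF \<alpha> assms])
  have 2: "\<bar>exp_avg \<beta> (\<lambda>s. f (- s)) (- x) - exp_avg \<beta> (\<lambda>s. g (- s)) (- x)\<bar> \<le> e"
    by (rule exp_avg_dist[OF \<beta> _ _ assms(3,4,5)]) simp_all
  have "G f x - G g x = ((exp_avg \<alpha> f x - exp_avg \<alpha> g x) / \<alpha>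
      + (exp_avg \<beta> (\<lambda>s. f (- s)) (- x) - exp_avg \<beta> (\<lambda>s. g (- s)) (- x)) / \<beta>) / (\<alpha> + \<beta>)"
    unfolding G_def by (simp add: diff_divide_distrib add_divide_distrib)
  also have "\<bar>\<dots>\<bar> \<le> (e / \<alpha> + e / \<beta>) / (\<alpha> + \<beta>)"
    using 1 2 \<alpha> \<beta>
    by (auto simp: abs_divide intro!: divide_right_mono order.trans[OF abs_triangle_ineq] add_mono)
  also have "\<dots> = e / (\<alpha> * \<beta>)"
    using \<alpha> \<beta> by (simp add: divide_simps) (simp add: algebra_simps)
  finally show ?thesis .
qed

lemma G_lipschitz:
  assumes [measurable]: "f \<in> borel_measurable borel" and B: "\<And>s. \<bar>f s\<bar> \<le> B"
  shows "\<bar>G f x - G f y\<bar> \<le> 4 * B / (\<alpha> + \<beta>) * \<bar>x - y\<bar>"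
proof -
  have 1: "\<bar>exp_avg \<alpha> f x - exp_avg \<alpha> f y\<bar> / \<alpha> \<le> 2 * B * \<bar>x - y\<bar>"
    using exp_avg_lipschitz[OF \<alpha> assms, of x y] \<alpha> by (simp add: divide_simps algebra_simps)
  have "\<bar>exp_avg \<beta> (\<lambda>s. f (- s)) (- x) - exp_avg \<beta> (\<lambda>s. f (- s)) (- y)\<bar> \<le> 2 * \<beta> * B * \<bar>- x - - y\<bar>"
    by (rule exp_avg_lipschitz[OF \<beta> _ B]) simp
  then have 2: "\<bar>exp_avg \<beta> (\<lambda>s. f (- s)) (- x) - exp_avg \<beta> (\<lambda>s. f (- s)) (- y)\<bar> / \<beta> \<le> 2 * B * \<bar>x - y\<bar>"
    using \<beta> by (simp add: divide_simps algebra_simps abs_minus_commute)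
  have "G f x - G f y = ((exp_avg \<alpha> f x - exp_avg \<alpha> f y) / \<alpha>
      + (exp_avg \<beta> (\<lambda>s. f (- s)) (- x) - exp_avg \<beta> (\<lambda>s. f (- s)) (- y)) / \<beta>) / (\<alpha> + \<beta>)"
    unfolding G_def by (simp add: diff_divide_distrib add_divide_distrib)
  also have "\<bar>\<dots>\<bar> \<le> (2 * B * \<bar>x - y\<bar> + 2 * B * \<bar>x - y\<bar>) / (\<alpha> + \<beta>)"
    using 1 2 \<alpha> \<beta>
    by (auto simp: abs_divide intro!: divide_right_mono order.trans[OF abs_triangle_ineq] add_mono)
  finally show ?thesis by simp
qed

lemma G_tendsto:
  assumes [measurable]: "\<And>n. f n \<in> borel_measurable borel" "g \<in> borel_measurable borel"
    and B: "\<And>n s. \<bar>f n s\<bar> \<le> B" and lim: "\<And>s. (\<lambda>n. f n s) \<longlonglongrightarrow> g s"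
  shows "(\<lambda>n. G (f n) x) \<longlonglongrightarrow> G g x"
proof -
  have "(\<lambda>n. exp_avg \<beta> (\<lambda>s. f n (- s)) (- x)) \<longlonglongrightarrow> exp_avg \<beta> (\<lambda>s. g (- s)) (- x)"
    by (rule exp_avg_tendsto[OF \<beta> _ _ B lim]) simp_all
  then show ?thesis
    unfolding G_def using \<alpha> \<beta>
    by (intro tendsto_intros exp_avg_tendsto[OF \<alpha> assms]) auto
qed

lemma G_shift: "G (\<lambda>s. f (s + h)) x = G f (x + h)"
  using exp_avg_shift[of \<alpha> f h x] exp_avg_shift[of \<beta> "\<lambda>s. f (- s)" "- h" "- x"]
  by (simp add: G_def algebra_simps)

text \<open>The forward part of the kernel reaches all points to the right of \<open>x\<close>, so a
  positive lower bound near \<open>+\<infinity>\<close> is felt everywhere.\<close>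

lemma G_pos:
  assumes [measurable]: "f \<in> borel_measurable borel" and f: "\<And>s. 0 \<le> f s" "\<And>s. f s \<le> B"
    and "a > 0" and ge: "\<And>s. s \<ge> X \<Longrightarrow> f s \<ge> a"
  shows "G f x > 0"
proof -
  \<comment> \<open>In reflected coordinates \<open>u\<close> is the smaller of \<open>- x\<close>
    and \<open>- X\<close>: at \<open>u\<close> the average sees only values at least
    \<open>a\<close>, and \<open>exp_avg_decay\<close> carries positivity from \<open>u\<close> to
    \<open>- x\<close>.\<close>
  define u where "u = - max x X"
  have "exp_avg \<beta> (\<lambda>_. a) u \<le> exp_avg \<beta> (\<lambda>s. f (- s)) u"
    using f \<beta> by (intro exp_avg_mono exp_avg_integrable[where B = B] exp_avg_integrable[where B = "\<bar>a\<bar>"] ge)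
      (auto simp: u_def)
  then have "exp_avg \<beta> (\<lambda>s. f (- s)) u > 0"
    using \<open>a > 0\<close> by (simp add: exp_avg_const \<beta>)
  then have "0 < exp (\<beta> * u) * exp_avg \<beta> (\<lambda>s. f (- s)) u" by simp
  also have "\<dots> \<le> exp (\<beta> * (- x)) * exp_avg \<beta> (\<lambda>s. f (- s)) (- x)"
    using f by (intro exp_avg_decay[OF \<beta>]) (auto simp: u_def)
  finally have "exp_avg \<beta> (\<lambda>s. f (- s)) (- x) > 0" by (simp add: zero_less_mult_iff)
  moreover have "exp_avg \<alpha> f x \<ge> 0" by (intro exp_avg_nonneg \<alpha> f)
  ultimately show ?thesis unfolding G_def using \<alpha> \<beta> by (intro divide_pos_pos add_nonneg_pos) auto
qed

text \<open>The defect of \<open>f\<close> below the constant \<open>a\<close> is dominated by a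
  decaying exponential, and \<open>G\<close> only rescales that exponential.\<close>

lemma G_eventually_ge:
  assumes "f \<in> borel_measurable borel" "\<And>s. 0 \<le> f s" "\<And>s. f s \<le> B"
    and "a \<ge> 0" "\<And>s. s \<ge> X \<Longrightarrow> f s \<ge> a" and v: "v < a / (\<alpha> * \<beta>)"
  shows "eventually (\<lambda>x. G f x \<ge> v) at_top"
proof -
  \<comment> \<open>Any exponent strictly between \<open>- \<alpha>\<close> and 0 serves;
    \<open>C\<close> is scaled so that the exponential equals \<open>a\<close> at
    \<open>X\<close>.\<close>
  define \<mu> where "\<mu> = - \<alpha> / 2"
  define C where "C = a * exp (\<mu> * (- X))"
  have \<mu>: "\<mu> < 0" "- \<alpha> < \<mu>" "\<mu> < \<beta>" using \<alpha> \<beta> by (auto simp: \<mu>_def)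
  have "f s \<ge> a - C * exp (\<mu> * s)" for s
  proof (cases "s \<ge> X")
    case True
    have "C * exp (\<mu> * s) \<ge> 0" using \<open>a \<ge> 0\<close> by (simp add: C_def)
    with assms(5)[OF True] show ?thesis by linarith
  next
    case False
    then have "1 \<le> exp (\<mu> * (- X)) * exp (\<mu> * s)"
      using \<mu> by (simp add: exp_add[symmetric] mult_le_cancel_left)
    from mult_left_mono[OF this \<open>a \<ge> 0\<close>] show ?thesis
      using assms(2)[of s] by (simp add: C_def mult.assoc)
  qed
  then have ge: "G f x \<ge> a / (\<alpha> * \<beta>) - C * exp (\<mu> * x) / ((\<alpha> + \<mu>) * (\<beta> - \<mu>))" for x
    using assms(1-3) \<mu> by (intro G_ge_exp[where B = B]) auto
  have "((\<lambda>x. exp (\<mu> * x)) \<longlongrightarrow> 0) at_top"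
    using \<mu> by real_asymp
  then have "((\<lambda>x. a / (\<alpha> * \<beta>) - C * exp (\<mu> * x) / ((\<alpha> + \<mu>) * (\<beta> - \<mu>)))
      \<longlongrightarrow> a / (\<alpha> * \<beta>) - C * 0 / ((\<alpha> + \<mu>) * (\<beta> - \<mu>))) at_top"
    using \<mu> \<alpha> \<beta> by (intro tendsto_intros) auto
  then have "eventually (\<lambda>x. a / (\<alpha> * \<beta>) - C * exp (\<mu> * x) / ((\<alpha> + \<mu>) * (\<beta> - \<mu>)) > v) at_top"
    using v by (intro order_tendstoD(1)) auto
  then show ?thesis
    by eventually_elim (use ge in \<open>force intro: less_imp_le less_le_trans\<close>)
qed

text \<open>The derivative of \<open>G f\<close> in closed form. The local terms \<open>f x\<close>
  of the two averages cancel, so continuity of \<open>f\<close> is enough to differentiate once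
  more.\<close>

definition G' :: "(real \<Rightarrow> real) \<Rightarrow> real \<Rightarrow> real" where
  "G' f x = (exp_avg \<beta> (\<lambda>s. f (- s)) (- x) - exp_avg \<alpha> f x) / (\<alpha> + \<beta>)"

lemma G_deriv:
  assumes f: "continuous_on UNIV f" and B: "\<And>s. \<bar>f s\<bar> \<le> B"
  shows "(G f has_real_derivative G' f x) (at x)"
    and "(G' f has_real_derivative (\<beta> - \<alpha>) * G' f x + \<alpha> * \<beta> * G f x - f x) (at x)"
proof -
  have 1 [derivative_intros]: "(exp_avg \<alpha> f has_real_derivative \<alpha> * (f x - exp_avg \<alpha> f x)) (at x)"
    by (rule exp_avg_deriv[OF \<alpha> f B])
  have "(exp_avg \<beta> (\<lambda>s. f (- s)) has_real_derivative
      \<beta> * (f (- (- x)) - exp_avg \<beta> (\<lambda>s. f (- s)) (- x))) (at (- x))"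
    by (rule exp_avg_deriv[OF \<beta> _ B])
       (intro continuous_on_compose2[OF f] continuous_intros, auto)
  from DERIV_chain2[where g = uminus and x = x and s = UNIV, OF this DERIV_minus[OF DERIV_ident]]
  have 2 [derivative_intros]: "((\<lambda>x. exp_avg \<beta> (\<lambda>s. f (- s)) (- x)) has_real_derivative
      - \<beta> * (f x - exp_avg \<beta> (\<lambda>s. f (- s)) (- x))) (at x)"
    by simp
  have ne: "\<alpha> + \<beta> \<noteq> 0" "\<alpha> \<noteq> 0" "\<beta> \<noteq> 0" using \<alpha> \<beta> by auto
  have "((\<lambda>x. (exp_avg \<alpha> f x / \<alpha> + exp_avg \<beta> (\<lambda>s. f (- s)) (- x) / \<beta>) / (\<alpha> + \<beta>)) has_real_derivative
     (\<alpha> * (f x - exp_avg \<alpha> f x) / \<alpha> + (- \<beta> * (f x - exp_avg \<beta> (\<lambda>s. f (- s)) (- x))) / \<beta>) / (\<alpha> + \<beta>)) (at x)"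
    using ne by (intro DERIV_cdivide DERIV_add 1 2)
  moreover have "(\<alpha> * (f x - u) / \<alpha> + (- \<beta> * (f x - v)) / \<beta>) / (\<alpha> + \<beta>) = (v - u) / (\<alpha> + \<beta>)" for u v
    using ne by simp
  ultimately show "(G f has_real_derivative G' f x) (at x)"
    unfolding G_def[abs_def] G'_def by (simp only:)
  have "((\<lambda>x. (exp_avg \<beta> (\<lambda>s. f (- s)) (- x) - exp_avg \<alpha> f x) / (\<alpha> + \<beta>)) has_real_derivative
     (- \<beta> * (f x - exp_avg \<beta> (\<lambda>s. f (- s)) (- x)) - \<alpha> * (f x - exp_avg \<alpha> f x)) / (\<alpha> + \<beta>)) (at x)"
    using ne by (intro DERIV_cdivide DERIV_diff 1 2)
  moreover have "(- \<beta> * (f x - v) - \<alpha> * (f x - u)) / (\<alpha> + \<beta>)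
     = (\<beta> - \<alpha>) * ((v - u) / (\<alpha> + \<beta>)) + \<alpha> * \<beta> * ((u / \<alpha> + v / \<beta>) / (\<alpha> + \<beta>)) - f x" for u v
    using ne by (simp add: divide_simps) (simp add: algebra_simps)
  ultimately show "(G' f has_real_derivative (\<beta> - \<alpha>) * G' f x + \<alpha> * \<beta> * G f x - f x) (at x)"
    unfolding G_def[abs_def] G'_def[abs_def] by simp
qed

end

section \<open>Approximate fixed points and convergent subsequences\<close>

text \<open>
  The library's Brouwer theorem carries the dimension in the type; here it grows along a
  sequence, hence the appeal to Kuhn's lemma.  Approximate fixed points are enough, since a limit
  is taken afterwards.
\<close>

lemma approximate_fixed_point:
  fixes F :: "(nat \<Rightarrow> real) \<Rightarrow> nat \<Rightarrow> real" and n :: nat and D e :: real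
  defines "cube \<equiv> {v. \<forall>i<n. 0 \<le> v i \<and> v i \<le> 1}"
  assumes range: "\<And>v. v \<in> cube \<Longrightarrow> F v \<in> cube"
    and lip: "\<And>v w h i. v \<in> cube \<Longrightarrow> w \<in> cube \<Longrightarrow> (\<And>j. j < n \<Longrightarrow> \<bar>v j - w j\<bar> \<le> h)
      \<Longrightarrow> i < n \<Longrightarrow> \<bar>F v i - F w i\<bar> \<le> D * h"
    and "e > 0"
  obtains v where "v \<in> cube" "\<And>i. i < n \<Longrightarrow> \<bar>F v i - v i\<bar> \<le> e"
proof -
  \<comment> \<open>The mesh width \<open>1 / p\<close> satisfies
    \<open>(\<bar>D\<bar> + 1) / p \<le> e\<close>: \<open>\<bar>D\<bar> / p\<close> pays for the
    variation of \<open>F\<close> across a cell and \<open>1 / p\<close> for that of the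
    coordinate.\<close>
  define p where "p = Suc (nat \<lceil>(\<bar>D\<bar> + 1) / e\<rceil>)"
  have p: "p > 0" by (simp add: p_def)
  have "(\<bar>D\<bar> + 1) / e \<le> p" unfolding p_def by linarith
  then have pe: "(\<bar>D\<bar> + 1) / p \<le> e" using \<open>e > 0\<close> p by (simp add: field_simps)
  define pt where "pt = (\<lambda>(x::nat \<Rightarrow> nat) i. real (x i) / real p)"
  have pt: "pt x \<in> cube" if "\<forall>i<n. x i \<le> p" for x
    using that p by (auto simp: cube_def pt_def)
  \<comment> \<open>Label 0 means that \<open>F\<close> does not decrease the coordinate, label 1
    that it does not increase it. Kuhn's lemma wants label 1 on the face \<open>x i = p\<close>,
    where the range of \<open>F\<close> makes it truthful.\<close>
  define label where "label = (\<lambda>x i. if x i \<noteq> p \<and> F (pt x) i \<ge> pt x i then 0 else (1::nat))"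
  obtain q where q: "\<forall>i<n. q i < p"
    and rs: "\<forall>i<n. \<exists>r s. (\<forall>j<n. q j \<le> r j \<and> r j \<le> q j + 1) \<and>
      (\<forall>j<n. q j \<le> s j \<and> s j \<le> q j + 1) \<and> label r i \<noteq> label s i"
  proof (rule kuhn_lemma[of p n label])
    show "\<forall>x. (\<forall>i<n. x i \<le> p) \<longrightarrow> (\<forall>i<n. x i = 0 \<longrightarrow> label x i = 0)"
      using range[OF pt] p by (auto simp: label_def pt_def cube_def)
  qed (use p in \<open>auto simp: label_def\<close>)
  show ?thesis
  proof
    show qc: "pt q \<in> cube" using q by (intro pt) auto
    fix i assume i: "i < n"
    have near: "pt q i \<le> pt z i" "pt z i \<le> pt q i + 1 / p" "\<bar>F (pt q) i - F (pt z) i\<bar> \<le> \<bar>D\<bar> / p" "pt z \<in> cube"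
      if z: "\<forall>j<n. q j \<le> z j \<and> z j \<le> q j + 1" for z
    proof -
      show zc: "pt z \<in> cube" using z q by (intro pt) (auto simp: Suc_le_eq intro: order.trans)
      have *: "real (q j) \<le> real (z j)" "real (z j) \<le> real (q j) + 1" if "j < n" for j
        using z that by (auto simp flip: of_nat_Suc)
      show le: "pt q i \<le> pt z i" "pt z i \<le> pt q i + 1 / p"
        using * i p by (auto simp: pt_def divide_simps)
      have "\<bar>pt q j - pt z j\<bar> \<le> 1 / p" if "j < n" for j
        using *[OF that] p by (auto simp: pt_def divide_simps)
      from lip[OF qc zc this i] have "\<bar>F (pt q) i - F (pt z) i\<bar> \<le> D * (1 / p)" .
      also have "\<dots> \<le> \<bar>D\<bar> / p" using p by (simp add: divide_simps)
      finally show "\<bar>F (pt q) i - F (pt z) i\<bar> \<le> \<bar>D\<bar> / p" .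
    qed
    obtain r s where r: "\<forall>j<n. q j \<le> r j \<and> r j \<le> q j + 1" "label r i = 0"
      and s: "\<forall>j<n. q j \<le> s j \<and> s j \<le> q j + 1" "label s i = 1"
    proof -
      obtain r s where *: "\<forall>j<n. q j \<le> r j \<and> r j \<le> q j + 1"
        "\<forall>j<n. q j \<le> s j \<and> s j \<le> q j + 1" "label r i \<noteq> label s i"
        using rs i by blast
      show thesis
      proof (cases "label r i = 0")
        case True
        then show ?thesis using * that[of r s] by (auto simp: label_def split: if_splits)
      next
        case False
        then show ?thesis using * that[of s r] by (auto simp: label_def split: if_splits)
      qed
    qed
    have "F (pt r) i \<ge> pt r i" using r(2) by (auto simp: label_def split: if_splits)
    moreover have "F (pt s) i \<le> pt s i"
    proof (cases "s i = p")
      case True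
      then show ?thesis using range[OF near(4)[OF s(1)]] i p by (auto simp: pt_def cube_def)
    qed (use s(2) in \<open>auto simp: label_def split: if_splits\<close>)
    \<comment> \<open>Corner \<open>r\<close> bounds \<open>F (pt q) i - pt q i\<close> from below
      and corner \<open>s\<close> from above.\<close>
    ultimately have "\<bar>F (pt q) i - pt q i\<bar> \<le> \<bar>D\<bar> / p + 1 / p"
      using near[OF r(1)] near[OF s(1)] by linarith
    then show "\<bar>F (pt q) i - pt q i\<bar> \<le> e" using pe by (simp add: add_divide_distrib)
  qed
qed

text \<open>The Arzela-Ascoli argument: a diagonal subsequence converges at all rationals, and the
  common Lipschitz constant extends the Cauchy property to every real. Pointwise convergence
  suffices for dominated convergence later.\<close>

lemma equi_lipschitz_subsequence:
  fixes f :: "nat \<Rightarrow> real \<Rightarrow> real"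
  assumes B: "\<And>n x. \<bar>f n x\<bar> \<le> B" and D: "\<And>n x y. \<bar>f n x - f n y\<bar> \<le> D * \<bar>x - y\<bar>"
  obtains r g where "strict_mono (r :: nat \<Rightarrow> nat)" "\<And>x. (\<lambda>n. f (r n) x) \<longlonglongrightarrow> g x"
proof -
  obtain r where r: "strict_mono (r :: nat \<Rightarrow> nat)" "\<And>x. x \<in> \<rat> \<Longrightarrow> \<exists>l. (\<lambda>n. f (r n) x) \<longlonglongrightarrow> l"
    using function_convergent_subsequence[OF countable_rat, of f B] B by auto
  have "convergent (\<lambda>n. f (r n) x)" for x
  proof -
    have "Cauchy (\<lambda>n. f (r n) x)"
    proof (rule metric_CauchyI)
      fix e :: real assume e: "e > 0"
      define h where "h = e / (3 * (\<bar>D\<bar> + 1))"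
      have h: "h > 0" using e by (simp add: h_def divide_pos_pos)
      obtain y where y: "y \<in> \<rat>" "x < y" "y < x + h"
        using Rats_dense_in_real[of x "x + h"] h by auto
      have "D * \<bar>x - y\<bar> \<le> \<bar>D\<bar> * h" using y by (intro mult_mono) auto
      also have "\<dots> < e / 3" using e by (simp add: h_def divide_simps)
      finally have xy: "\<bar>f n x - f n y\<bar> < e / 3" for n using D[of n x y] by linarith
      have "Cauchy (\<lambda>n. f (r n) y)" using r(2)[OF y(1)] LIMSEQ_imp_Cauchy by blast
      then obtain N where N: "\<And>m n. m \<ge> N \<Longrightarrow> n \<ge> N \<Longrightarrow> dist (f (r m) y) (f (r n) y) < e / 3"
        using e unfolding Cauchy_def by (meson divide_pos_pos zero_less_numeral)
      have "dist (f (r m) x) (f (r n) x) < e" if "m \<ge> N" "n \<ge> N" for m n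
        using N[OF that] xy[of "r m"] xy[of "r n"] unfolding dist_real_def by linarith
      then show "\<exists>M. \<forall>m\<ge>M. \<forall>n\<ge>M. dist (f (r m) x) (f (r n) x) < e" by blast
    qed
    then show ?thesis by (simp add: Cauchy_convergent)
  qed
  then show ?thesis using that[OF r(1), of "\<lambda>x. lim (\<lambda>n. f (r n) x)"] by (simp add: convergent_LIMSEQ_iff)
qed

section \<open>Fixed points of the delayed problem\<close>

lemma max_dist: "\<bar>max a x - max a' x'\<bar> \<le> max \<bar>a - a'\<bar> \<bar>x - x'\<bar>" for a a' x x' :: real
  by (auto simp: max_def abs_if)

text \<open>The exponential has derivative at most 1 on the negative axis; this bounds the Lipschitz
  constant of the source, whose exponent is never positive.\<close>

lemma exp_lipschitz_nonpos:
  fixes x y :: real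
  assumes "x \<le> 0" "y \<le> 0"
  shows "\<bar>exp x - exp y\<bar> \<le> \<bar>x - y\<bar>"
proof -
  have *: "exp u - exp v \<le> u - v" if "v \<le> u" "u \<le> 0" for u v :: real
  proof -
    have "exp u - exp v = exp u * (1 - exp (v - u))" by (simp add: exp_diff algebra_simps)
    also have "1 - exp (v - u) \<le> u - v" using exp_ge_add_one_self[of "v - u"] by linarith
    then have "exp u * (1 - exp (v - u)) \<le> 1 * (u - v)"
      using that by (intro mult_mono) auto
    finally show ?thesis by simp
  qed
  show ?thesis using *[of x y] *[of y x] assms by (cases x y rule: linorder_le_cases) auto
qed

text \<open>Here \<open>\<alpha> * \<beta>\<close> stands for \<open>d\<close>, \<open>p\<close> for
  \<open>b' 0\<close> and \<open>\<kappa>\<close> for \<open>calK\<close>. With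
  \<open>\<beta> - \<alpha> = c\<close>, the assumption \<open>supersolution\<close> is
  \<open>Lam \<le> 0\<close> at \<open>l\<close>, written with the factored characteristic
  polynomial.\<close>

locale delay_wave = green_operator \<alpha> \<beta> for \<alpha> \<beta> +
  fixes b \<tau> :: "real \<Rightarrow> real" and c p m l \<kappa> D\<^sub>b :: real
  assumes \<kappa>: "\<kappa> > 0" and c: "c \<ge> 0" and l: "0 < l" "l < \<beta>"
    and b_lip: "\<And>u v. u \<in> {0..\<kappa>} \<Longrightarrow> v \<in> {0..\<kappa>} \<Longrightarrow> \<bar>b u - b v\<bar> \<le> D\<^sub>b * \<bar>u - v\<bar>"
    and b_ge: "\<And>u. u \<in> {0..\<kappa>} \<Longrightarrow> 0 \<le> b u"
    and b_le: "\<And>u. u \<in> {0..\<kappa>} \<Longrightarrow> b u \<le> \<alpha> * \<beta> * \<kappa>"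
    and b_le_linear: "\<And>u. u \<in> {0..\<kappa>} \<Longrightarrow> b u \<le> p * u"
    and \<tau>_lip: "\<And>u v. u \<ge> 0 \<Longrightarrow> v \<ge> 0 \<Longrightarrow> \<bar>\<tau> u - \<tau> v\<bar> \<le> \<bar>u - v\<bar>"
    and \<tau>_ge: "\<And>u. u \<ge> 0 \<Longrightarrow> m \<le> \<tau> u"
    and p: "p \<ge> 0" and supersolution: "p * exp (- (l * c * m)) \<le> (\<alpha> + l) * (\<beta> - l)"
begin

text \<open>The class of right-hand sides. Mere measurability admits step functions, and the upper
  bound is the one that \<open>G\<close> divides down to \<open>\<kappa>\<close>.\<close>

definition admissible :: "(real \<Rightarrow> real) \<Rightarrow> bool" where
  "admissible f \<longleftrightarrow> f \<in> borel_measurable borel \<and> (\<forall>s. 0 \<le> f s \<and> f s \<le> \<alpha> * \<beta> * \<kappa>)"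

text \<open>The Lipschitz constant that \<open>G_lipschitz\<close> gives to \<open>G f\<close> for
  every admissible \<open>f\<close>.\<close>

definition D :: real where "D = 4 * (\<alpha> * \<beta> * \<kappa>) / (\<alpha> + \<beta>)"

definition profile :: "(real \<Rightarrow> real) \<Rightarrow> bool" where
  "profile \<phi> \<longleftrightarrow> (\<forall>x. \<phi> x \<in> {0..\<kappa>}) \<and> (\<forall>x y. \<bar>\<phi> x - \<phi> y\<bar> \<le> D * \<bar>x - y\<bar>)"

definition delayed :: "(real \<Rightarrow> real) \<Rightarrow> real \<Rightarrow> real" where
  "delayed \<phi> s = \<phi> (s - c * \<tau> (\<phi> s))"

text \<open>Since \<open>b\<close> is nonnegative on the range of a profile, \<open>g = 0\<close>
  gives back the original nonlinearity.\<close>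

definition R :: "(real \<Rightarrow> real) \<Rightarrow> (real \<Rightarrow> real) \<Rightarrow> real \<Rightarrow> real" where
  "R g \<phi> s = max (b (delayed \<phi> s)) (g s)"

section \<open>Invariant bounds and Lipschitz estimates\<close>

lemma D_nonneg: "D \<ge> 0" using \<alpha> \<beta> \<kappa> by (simp add: D_def)

lemma D\<^sub>b_nonneg: "D\<^sub>b \<ge> 0"
proof -
  have "0 \<le> D\<^sub>b * \<bar>0 - \<kappa>\<bar>"
    by (rule order.trans[OF abs_ge_zero b_lip]) (use \<kappa> in auto)
  then show ?thesis using \<kappa> by (simp add: zero_le_mult_iff)
qed

lemma admissible_bound: "admissible f \<Longrightarrow> \<bar>f s\<bar> \<le> \<alpha> * \<beta> * \<kappa>"
  by (simp add: admissible_def)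

lemma admissible_profile:
  assumes "admissible f"
  shows "profile (G f)"
proof -
  have m: "f \<in> borel_measurable borel" using assms by (simp add: admissible_def)
  have "G f x \<le> (\<alpha> * \<beta> * \<kappa>) / (\<alpha> * \<beta>)" for x
    using assms by (intro G_le_const) (auto simp: admissible_def)
  moreover have "G f x \<ge> 0" for x using assms by (intro G_nonneg) (auto simp: admissible_def)
  moreover have "\<bar>G f x - G f y\<bar> \<le> D * \<bar>x - y\<bar>" for x y
    unfolding D_def by (rule G_lipschitz[OF m admissible_bound[OF assms]])
  ultimately show ?thesis using \<alpha> \<beta> by (simp add: profile_def)
qed

lemma delayed_range: "profile \<phi> \<Longrightarrow> delayed \<phi> s \<in> {0..\<kappa>}"
  by (simp add: profile_def delayed_def)

lemma profile_range: "profile \<phi> \<Longrightarrow> \<phi> s \<in> {0..\<kappa>}" "profile \<phi> \<Longrightarrow> 0 \<le> \<phi> s"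
  by (simp_all add: profile_def)

lemma profile_lip: "profile \<phi> \<Longrightarrow> \<bar>\<phi> x - \<phi> y\<bar> \<le> D * \<bar>x - y\<bar>"
  by (simp add: profile_def)

lemma profile_continuous: "profile \<phi> \<Longrightarrow> continuous_on UNIV \<phi>"
  by (rule lipschitz_on_continuous_on[of D]) (auto simp: lipschitz_on_def profile_def D_nonneg dist_real_def)

text \<open>The delay depends on the state: \<open>h\<close> accounts for the change of function at
  a fixed argument, and \<open>c * D * h\<close> for the shift of the argument by at most
  \<open>c * h\<close>, seen through the Lipschitz constant of the profile.\<close>

lemma delayed_dist:
  assumes \<phi>: "profile \<phi>" and \<psi>: "profile \<psi>" and h: "\<And>x. \<bar>\<phi> x - \<psi> x\<bar> \<le> h"
  shows "\<bar>delayed \<phi> s - delayed \<psi> s\<bar> \<le> (1 + c * D) * h"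
proof -
  have "\<bar>(s - c * \<tau> (\<phi> s)) - (s - c * \<tau> (\<psi> s))\<bar> = c * \<bar>\<tau> (\<phi> s) - \<tau> (\<psi> s)\<bar>"
    using c by (simp add: abs_mult[symmetric] right_diff_distrib[symmetric] abs_minus_commute flip: abs_mult)
      (simp add: abs_mult abs_minus_commute)
  also have "\<dots> \<le> c * h"
    using order.trans[OF \<tau>_lip h, of s] profile_range[OF \<phi>, of s] profile_range[OF \<psi>, of s] c by (intro mult_left_mono) auto
  finally have "D * \<bar>(s - c * \<tau> (\<phi> s)) - (s - c * \<tau> (\<psi> s))\<bar> \<le> D * (c * h)"
    using D_nonneg by (intro mult_left_mono)
  then have "\<bar>\<psi> (s - c * \<tau> (\<phi> s)) - \<psi> (s - c * \<tau> (\<psi> s))\<bar> \<le> D * (c * h)"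
    using profile_lip[OF \<psi>, of "s - c * \<tau> (\<phi> s)" "s - c * \<tau> (\<psi> s)"] by linarith
  then show ?thesis
    using h[of "s - c * \<tau> (\<phi> s)"] unfolding delayed_def by (simp add: algebra_simps)
qed

lemma delayed_lip:
  assumes \<phi>: "profile \<phi>"
  shows "\<bar>delayed \<phi> s - delayed \<phi> t\<bar> \<le> D * (1 + c * D) * \<bar>s - t\<bar>"
proof -
  have "\<bar>(s - c * \<tau> (\<phi> s)) - (t - c * \<tau> (\<phi> t))\<bar> \<le> \<bar>s - t\<bar> + c * \<bar>\<tau> (\<phi> s) - \<tau> (\<phi> t)\<bar>"
  proof -
    have "(s - c * \<tau> (\<phi> s)) - (t - c * \<tau> (\<phi> t)) = (s - t) - c * (\<tau> (\<phi> s) - \<tau> (\<phi> t))"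
      by (simp add: algebra_simps)
    then show ?thesis using c abs_triangle_ineq4[of "s - t" "c * (\<tau> (\<phi> s) - \<tau> (\<phi> t))"] by (simp add: abs_mult)
  qed
  also have "\<bar>\<tau> (\<phi> s) - \<tau> (\<phi> t)\<bar> \<le> D * \<bar>s - t\<bar>"
    using \<tau>_lip[of "\<phi> s" "\<phi> t"] profile_lip[OF \<phi>, of s t] profile_range[OF \<phi>, of s] profile_range[OF \<phi>, of t] by auto
  finally have "\<bar>(s - c * \<tau> (\<phi> s)) - (t - c * \<tau> (\<phi> t))\<bar> \<le> \<bar>s - t\<bar> + c * (D * \<bar>s - t\<bar>)"
    using c by (simp add: mult_left_mono)
  then have "D * \<bar>(s - c * \<tau> (\<phi> s)) - (t - c * \<tau> (\<phi> t))\<bar> \<le> D * (\<bar>s - t\<bar> + c * (D * \<bar>s - t\<bar>))"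
    using D_nonneg by (rule mult_left_mono)
  then show ?thesis
    using profile_lip[OF \<phi>, of "s - c * \<tau> (\<phi> s)" "t - c * \<tau> (\<phi> t)"] unfolding delayed_def by (simp add: algebra_simps)
qed

lemma R_dist:
  assumes "profile \<phi>" "profile \<psi>" "\<And>x. \<bar>\<phi> x - \<psi> x\<bar> \<le> h"
  shows "\<bar>R g \<phi> s - R g \<psi> s\<bar> \<le> D\<^sub>b * ((1 + c * D) * h)"
proof -
  have "\<bar>R g \<phi> s - R g \<psi> s\<bar> \<le> \<bar>b (delayed \<phi> s) - b (delayed \<psi> s)\<bar>"
    unfolding R_def using max_dist[of "b (delayed \<phi> s)" "g s" "b (delayed \<psi> s)" "g s"] by simp
  also have "\<dots> \<le> D\<^sub>b * \<bar>delayed \<phi> s - delayed \<psi> s\<bar>" using assms by (intro b_lip delayed_range)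
  also have "\<dots> \<le> D\<^sub>b * ((1 + c * D) * h)" using assms D\<^sub>b_nonneg by (intro mult_left_mono delayed_dist)
  finally show ?thesis .
qed

lemma R_lip:
  assumes "profile \<phi>" and g: "\<And>s t. \<bar>g s - g t\<bar> \<le> D\<^sub>g * \<bar>s - t\<bar>"
  shows "\<bar>R g \<phi> s - R g \<phi> t\<bar> \<le> (D\<^sub>b * (D * (1 + c * D)) + \<bar>D\<^sub>g\<bar>) * \<bar>s - t\<bar>"
proof -
  have "\<bar>b (delayed \<phi> s) - b (delayed \<phi> t)\<bar> \<le> D\<^sub>b * \<bar>delayed \<phi> s - delayed \<phi> t\<bar>" using assms by (intro b_lip delayed_range)
  also have "\<dots> \<le> D\<^sub>b * (D * (1 + c * D) * \<bar>s - t\<bar>)" using assms D\<^sub>b_nonneg by (intro mult_left_mono delayed_lip)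
  finally have 1: "\<bar>b (delayed \<phi> s) - b (delayed \<phi> t)\<bar> \<le> D\<^sub>b * (D * (1 + c * D)) * \<bar>s - t\<bar>" by (simp add: mult.assoc)
  have "D\<^sub>g * \<bar>s - t\<bar> \<le> \<bar>D\<^sub>g\<bar> * \<bar>s - t\<bar>" by (intro mult_right_mono) auto
  then have 2: "\<bar>g s - g t\<bar> \<le> \<bar>D\<^sub>g\<bar> * \<bar>s - t\<bar>" using g[of s t] by linarith
  have "0 \<le> D\<^sub>b * (D * (1 + c * D)) * \<bar>s - t\<bar>" using D\<^sub>b_nonneg D_nonneg c by simp
  with 1 2 show ?thesis
    unfolding R_def distrib_right using max_dist[of "b (delayed \<phi> s)" "g s" "b (delayed \<phi> t)" "g t"] by linarith
qed

lemma R_range: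
  assumes "profile \<phi>" "0 \<le> g s" "g s \<le> \<alpha> * \<beta> * \<kappa>"
  shows "0 \<le> R g \<phi> s" "R g \<phi> s \<le> \<alpha> * \<beta> * \<kappa>"
  using assms b_le[OF delayed_range, of \<phi> s] by (auto simp: R_def)

text \<open>\<open>b_le_linear\<close> linearises, \<open>\<tau>_ge\<close> replaces the delay by
  its lower bound \<open>m\<close> since the exponential increases, and \<open>supersolution\<close>
  absorbs the factor.\<close>

lemma R_le_exp:
  assumes \<phi>: "profile \<phi>" and e: "\<And>x. \<phi> x \<le> exp (l * x)" and g: "g s \<le> (\<alpha> + l) * (\<beta> - l) * exp (l * s)"
  shows "R g \<phi> s \<le> (\<alpha> + l) * (\<beta> - l) * exp (l * s)"
proof -
  have "b (delayed \<phi> s) \<le> p * delayed \<phi> s" by (rule b_le_linear[OF delayed_range[OF \<phi>]])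
  also have "\<dots> \<le> p * exp (l * (s - c * \<tau> (\<phi> s)))" unfolding delayed_def by (intro mult_left_mono e p)
  also have "\<dots> \<le> p * exp (l * (s - c * m))"
    using \<tau>_ge[OF profile_range(2)[OF \<phi>], of s] c l p by (intro mult_left_mono) (auto intro!: mult_left_mono)
  also have "\<dots> = p * exp (- (l * c * m)) * exp (l * s)"
    by (simp add: algebra_simps exp_add[symmetric])
  also have "\<dots> \<le> (\<alpha> + l) * (\<beta> - l) * exp (l * s)" by (intro mult_right_mono supersolution) simp
  finally show ?thesis using g by (simp add: R_def)
qed

text \<open>The assumed bound on \<open>f\<close> is the exponential that \<open>G\<close> turns
  into \<open>exp (l * x)\<close>. Together with \<open>R_le_exp\<close> this makes the upper bound
  \<open>exp (l * x)\<close> invariant under the fixed-point map.\<close>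

lemma G_le_supersolution:
  assumes "admissible f" "\<And>s. f s \<le> (\<alpha> + l) * (\<beta> - l) * exp (l * s)"
  shows "G f x \<le> exp (l * x)"
proof -
  have "G f x \<le> 0 / (\<alpha> * \<beta>) + (\<alpha> + l) * (\<beta> - l) * exp (l * x) / ((\<alpha> + l) * (\<beta> - l))"
    using assms l \<alpha> by (intro G_le_exp[OF _ admissible_bound[OF assms(1)]]) (auto simp: admissible_def)
  then show ?thesis using \<alpha> l by simp
qed

section \<open>Existence of solutions with a source\<close>

text \<open>The functions \<open>G (f n)\<close> are equi-Lipschitz, so a subsequence converges;
  \<open>R\<close> is continuous along it, and dominated convergence passes to the limit in
  \<open>G\<close>. This serves both the refinement of the mesh and the removal of the
  source.\<close>

lemma compactness:
  assumes f: "\<And>n. admissible (f n)" and g: "\<And>s. 0 \<le> g s" "\<And>s. g s \<le> \<alpha> * \<beta> * \<kappa>"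
    and lim: "\<And>s. (\<lambda>n. f n s - R g (G (f n)) s) \<longlonglongrightarrow> 0"
  obtains r \<phi> where "strict_mono (r :: nat \<Rightarrow> nat)" "\<And>x. (\<lambda>n. G (f (r n)) x) \<longlonglongrightarrow> \<phi> x"
    "profile \<phi>" "admissible (R g \<phi>)" "\<phi> = G (R g \<phi>)"
proof -
  note profile = admissible_profile[OF f]
  obtain r \<phi> where r: "strict_mono (r :: nat \<Rightarrow> nat)" and \<phi>: "\<And>x. (\<lambda>n. G (f (r n)) x) \<longlonglongrightarrow> \<phi> x"
    using profile by (rule_tac equi_lipschitz_subsequence[of "\<lambda>n. G (f n)" \<kappa> D]) (auto simp: profile_def)
  have "0 \<le> \<phi> x" "\<phi> x \<le> \<kappa>" for x
    using profile \<phi>[of x] by (auto simp: profile_def intro: LIMSEQ_le_const LIMSEQ_le_const2)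
  moreover have "\<bar>\<phi> x - \<phi> y\<bar> \<le> D * \<bar>x - y\<bar>" for x y
    using profile by (intro LIMSEQ_le_const2[OF tendsto_rabs[OF tendsto_diff[OF \<phi> \<phi>]]]) (auto simp: profile_def)
  ultimately have p\<phi>: "profile \<phi>" by (simp add: profile_def)
  have delayed: "(\<lambda>n. delayed (G (f (r n))) s) \<longlonglongrightarrow> delayed \<phi> s" for s
  proof -
    define y where "y = s - c * \<tau> (\<phi> s)"
    have 1: "(\<lambda>n. G (f (r n)) y) \<longlonglongrightarrow> \<phi> y" by (rule \<phi>)
    \<comment> \<open>Convergence at the fixed argument \<open>y\<close> is separated from the
      motion of the argument, which the common Lipschitz constant controls.\<close>
    have "(\<lambda>n. G (f (r n)) (s - c * \<tau> (G (f (r n)) s)) - G (f (r n)) y) \<longlonglongrightarrow> 0"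
    proof (rule Lim_null_comparison)
      show "(\<lambda>n. D * (c * \<bar>G (f (r n)) s - \<phi> s\<bar>)) \<longlonglongrightarrow> 0"
        using tendsto_mult_right_zero[OF tendsto_mult_right_zero[OF tendsto_rabs_zero[OF LIM_zero[OF \<phi>[of s]]]]] .
      have "\<bar>G (f (r n)) (s - c * \<tau> (G (f (r n)) s)) - G (f (r n)) y\<bar> \<le> D * (c * \<bar>G (f (r n)) s - \<phi> s\<bar>)" for n
      proof -
        have "\<bar>s - c * \<tau> (G (f (r n)) s) - y\<bar> = c * \<bar>\<tau> (G (f (r n)) s) - \<tau> (\<phi> s)\<bar>"
          unfolding y_def using c by (simp add: abs_minus_commute abs_mult flip: right_diff_distrib)
        also have "\<dots> \<le> c * \<bar>G (f (r n)) s - \<phi> s\<bar>"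
          using c by (intro mult_left_mono \<tau>_lip profile_range(2)[OF profile] profile_range(2)[OF p\<phi>])
        finally show ?thesis
          using profile_lip[OF profile, of "r n" "s - c * \<tau> (G (f (r n)) s)" y] D_nonneg
          by (meson mult_left_mono order_trans)
      qed
      then show "\<forall>\<^sub>F n in sequentially. norm (G (f (r n)) (s - c * \<tau> (G (f (r n)) s)) - G (f (r n)) y)
          \<le> D * (c * \<bar>G (f (r n)) s - \<phi> s\<bar>)" by simp
    qed
    from tendsto_add[OF this 1] show ?thesis by (simp add: delayed_def y_def)
  qed
  have "(\<lambda>n. b (delayed (G (f (r n))) s)) \<longlonglongrightarrow> b (delayed \<phi> s)" for s
  proof (rule LIM_zero_cancel, rule Lim_null_comparison)
    show "(\<lambda>n. D\<^sub>b * \<bar>delayed (G (f (r n))) s - delayed \<phi> s\<bar>) \<longlonglongrightarrow> 0"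
      by (intro tendsto_mult_right_zero tendsto_rabs_zero LIM_zero delayed)
    show "\<forall>\<^sub>F n in sequentially. norm (b (delayed (G (f (r n))) s) - b (delayed \<phi> s)) \<le> D\<^sub>b * \<bar>delayed (G (f (r n))) s - delayed \<phi> s\<bar>"
      using b_lip[OF delayed_range[OF profile] delayed_range[OF p\<phi>]] by simp
  qed
  then have Rlim: "(\<lambda>n. R g (G (f (r n))) s) \<longlonglongrightarrow> R g \<phi> s" for s
    unfolding R_def by (intro tendsto_intros)
  \<comment> \<open>Convergence of \<open>f (r n)\<close> itself is a consequence: the residual
    vanishes and \<open>R\<close> has a limit.\<close>
  have fr: "(\<lambda>n. f (r n) s) \<longlonglongrightarrow> R g \<phi> s" for s
    using tendsto_add[OF LIMSEQ_subseq_LIMSEQ[OF lim[of s] r] Rlim[of s]] by (simp add: o_def)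
  have fm: "f n \<in> borel_measurable borel" for n using f[of n] by (simp add: admissible_def)
  have "R g \<phi> \<in> borel_measurable borel"
    by (rule borel_measurable_LIMSEQ_real[OF fr fm])
  then have admissible: "admissible (R g \<phi>)" using R_range[OF p\<phi>, of g] g by (simp add: admissible_def)
  have "(\<lambda>n. G (f (r n)) x) \<longlonglongrightarrow> G (R g \<phi>) x" for x
    using admissible admissible_bound[OF f] fm by (intro G_tendsto fr) (auto simp: admissible_def)
  then have "\<phi> = G (R g \<phi>)" using LIMSEQ_unique[OF \<phi>] by blast
  with that[OF r \<phi> p\<phi> admissible] show thesis .
qed

text \<open>
  The unknowns are the values of the nonlinearity \<open>f\<close>, a step function, rather than those of the
  profile: \<open>G f\<close> is then Lipschitz with a constant independent of the mesh.
\<close>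

lemma approximate_solution:
  fixes n :: nat
  assumes g: "\<And>s. 0 \<le> g s" "\<And>s. g s \<le> \<alpha> * \<beta> * \<kappa>" "\<And>s. g s \<le> (\<alpha> + l) * (\<beta> - l) * exp (l * s)"
    and g_lip: "\<And>s t. \<bar>g s - g t\<bar> \<le> D\<^sub>g * \<bar>s - t\<bar>"
    and e: "e > 0"
  obtains f where "admissible f" "\<And>s. f s \<le> (\<alpha> + l) * (\<beta> - l) * exp (l * s)"
    "\<And>s. - real n \<le> s \<Longrightarrow> s < real n \<Longrightarrow> \<bar>f s - R g (G f) s\<bar> \<le> e"
proof -
  define A where "A = (\<alpha> + l) * (\<beta> - l)"
  define H where "H = \<alpha> * \<beta> * \<kappa>"
  have A: "A > 0" and H: "H > 0" using \<alpha> \<beta> l \<kappa> by (auto simp: A_def H_def)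
  define E where "E = D\<^sub>b * (D * (1 + c * D)) + \<bar>D\<^sub>g\<bar>"
  have E: "E \<ge> 0" using D\<^sub>b_nonneg D_nonneg c by (simp add: E_def)
  \<comment> \<open>Mesh width \<open>1 / N\<close> makes \<open>R\<close> vary by at most
    \<open>e / 2\<close> over a cell; the other half of \<open>e\<close> is left for the fixed
    point.\<close>
  define N where "N = Suc (nat \<lceil>2 * E / e\<rceil>)"
  have N: "N > 0" by (simp add: N_def)
  have "2 * E / e \<le> N" unfolding N_def by linarith
  then have NE: "E * (1 / N) \<le> e / 2" using e N by (simp add: field_simps)
  \<comment> \<open>The window \<open>[- n, n)\<close> is cut into \<open>2 * n * N\<close> cells,
    and \<open>node\<close> gives their left ends.\<close>
  define node where "node = (\<lambda>i. real i / N - n)"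
  define cell where "cell = (\<lambda>s::real. nat \<lfloor>(s + n) * N\<rfloor>)"
  have cell: "cell s < 2 * n * N" "node (cell s) \<le> s" "s - node (cell s) \<le> 1 / N"
    if "- real n \<le> s" "s < real n" for s :: real
  proof -
    have nn: "0 \<le> (s + n) * N" using that by simp
    have *: "real (cell s) \<le> (s + n) * N" "(s + n) * N < real (cell s) + 1"
      unfolding cell_def using nn by linarith+
    have "(s + n) * N < (2 * real n) * N" using that N by (intro mult_strict_right_mono) auto
    then have "real (cell s) < real (2 * n * N)" using * by simp
    then show "cell s < 2 * n * N" by (simp only: of_nat_less_iff)
    have "real (cell s) / N \<le> s + n" "s + n \<le> (real (cell s) + 1) / N"
      using * N by (simp_all add: pos_divide_le_eq pos_le_divide_eq)
    then show "node (cell s) \<le> s" "s - node (cell s) \<le> 1 / N"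
      by (simp_all add: node_def add_divide_distrib)
  qed
  \<comment> \<open>The largest value that both bounds on \<open>f\<close> permit. Coordinates are
    fractions of it, which yields the unit cube; as \<open>C\<close> is nondecreasing, its value at
    a left end is permitted on the whole cell.\<close>
  define C where "C = (\<lambda>x. min H (A * exp (l * x)))"
  have C: "C x > 0" "C x \<le> H" "C x \<le> A * exp (l * x)" for x
    using A H by (auto simp: C_def)
  have C_mono: "C x \<le> C y" if "x \<le> y" for x y
    using that A l unfolding C_def by (intro min.mono mult_left_mono) auto
  define cube where "cube = {v :: nat \<Rightarrow> real. \<forall>i<2 * n * N. 0 \<le> v i \<and> v i \<le> 1}"
  define step where "step = (\<lambda>v s. if - real n \<le> s \<and> s < real n then C (node (cell s)) * v (cell s) else 0)"
  have step_meas [measurable]: "step v \<in> borel_measurable borel" for v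
  proof -
    have "(\<lambda>s::real. \<lfloor>(s + n) * N\<rfloor>) \<in> borel \<rightarrow>\<^sub>M count_space UNIV"
      by (rule measurable_compose[OF _ measurable_real_floor]) simp
    then have "(\<lambda>s::real. (\<lambda>i. C (node (nat i)) * v (nat i)) \<lfloor>(s + n) * N\<rfloor>) \<in> borel_measurable borel"
      by (rule measurable_compose) simp
    then show ?thesis unfolding step_def cell_def by (intro measurable_If) auto
  qed
  have step_range: "0 \<le> step v s" "step v s \<le> H" "step v s \<le> A * exp (l * s)" if "v \<in> cube" for v s
  proof -
    have "0 \<le> step v s \<and> step v s \<le> H \<and> step v s \<le> A * exp (l * s)"
    proof (cases "- real n \<le> s \<and> s < real n")
      case True
      then have v: "0 \<le> v (cell s)" "v (cell s) \<le> 1" using that cell[of s] by (auto simp: cube_def)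
      have s: "step v s = C (node (cell s)) * v (cell s)" using True by (simp add: step_def)
      also have "\<dots> \<le> C (node (cell s)) * 1" using v C by (intro mult_left_mono) (auto intro: less_imp_le)
      also have "\<dots> \<le> C s" using cell True by (simp add: C_mono)
      finally have "step v s \<le> C s" .
      moreover have "0 \<le> step v s" unfolding s using v less_imp_le[OF C(1)] by simp
      ultimately show ?thesis using C[of s] by linarith
    qed (use A H in \<open>auto simp: step_def less_imp_le\<close>)
    then show "0 \<le> step v s" "step v s \<le> H" "step v s \<le> A * exp (l * s)" by auto
  qed
  have admissible: "admissible (step v)" if "v \<in> cube" for v
    using step_range[OF that] by (simp add: admissible_def H_def)
  have le_exp: "G (step v) x \<le> exp (l * x)" if "v \<in> cube" for v x
    using step_range[OF that] by (intro G_le_supersolution admissible that) (simp add: A_def)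
  define F where "F = (\<lambda>v i. R g (G (step v)) (node i) / C (node i))"
  \<comment> \<open>\<open>C (- real n)\<close> is a lower bound for all the denominators
    \<open>C (node i)\<close>.\<close>
  define D' where "D' = D\<^sub>b * ((1 + c * D) * \<kappa>) / C (- real n)"
  \<comment> \<open>The tolerance \<open>e / (2 * H)\<close> becomes \<open>e / 2\<close> after
    multiplication by \<open>C \<le> H\<close>.\<close>
  obtain v where v: "v \<in> cube" and fix_v: "\<And>i. i < 2 * n * N \<Longrightarrow> \<bar>F v i - v i\<bar> \<le> e / (2 * H)"
  proof (rule approximate_fixed_point[of "2 * n * N" F D' "e / (2 * H)", folded cube_def])
    show "F v \<in> cube" if v: "v \<in> cube" for v
    proof -
      have "0 \<le> R g (G (step v)) x" "R g (G (step v)) x \<le> C x" for x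
        using R_range[where g = g and s = x, OF admissible_profile[OF admissible[OF v]] g(1,2)]
          R_le_exp[where g = g and s = x, OF admissible_profile[OF admissible[OF v]] le_exp[OF v] g(3)]
        by (auto simp: C_def A_def H_def)
      then show ?thesis using C(1) by (auto simp: cube_def F_def less_imp_le)
    qed
    fix v w h i assume v: "v \<in> cube" and w: "w \<in> cube" and i: "i < 2 * n * N"
      and h: "\<And>j. j < 2 * n * N \<Longrightarrow> \<bar>v j - w j\<bar> \<le> h"
    have h0: "h \<ge> 0" using h[OF i] by linarith
    have "\<bar>step v s - step w s\<bar> \<le> H * h" for s
    proof (cases "- real n \<le> s \<and> s < real n")
      case True
      then have "\<bar>step v s - step w s\<bar> = C (node (cell s)) * \<bar>v (cell s) - w (cell s)\<bar>"
        using less_imp_le[OF C(1), of "node (cell s)"]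
        by (simp add: step_def abs_mult flip: right_diff_distrib)
      also have "\<dots> \<le> H * h" using True h[OF cell(1)] C(2) H by (intro mult_mono) auto
      finally show ?thesis .
    qed (use H h0 in \<open>auto simp: step_def\<close>)
    then have "\<bar>G (step v) x - G (step w) x\<bar> \<le> H * h / (\<alpha> * \<beta>)" for x
      using admissible_bound[OF admissible[OF v]] admissible_bound[OF admissible[OF w]] by (intro G_dist) auto
    then have "\<bar>G (step v) x - G (step w) x\<bar> \<le> \<kappa> * h" for x
      using \<alpha> \<beta> by (simp add: H_def)
    then have R: "\<bar>R g (G (step v)) (node i) - R g (G (step w)) (node i)\<bar> \<le> D\<^sub>b * ((1 + c * D) * (\<kappa> * h))"
      by (intro R_dist admissible_profile admissible v w)
    have "\<bar>F v i - F w i\<bar> = \<bar>R g (G (step v)) (node i) - R g (G (step w)) (node i)\<bar> / C (node i)"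
      using less_imp_le[OF C(1), of "node i"] by (simp add: F_def flip: diff_divide_distrib)
    also have "\<dots> \<le> D\<^sub>b * ((1 + c * D) * (\<kappa> * h)) / C (- real n)"
      by (intro frac_le R C C_mono) (use D\<^sub>b_nonneg c D_nonneg \<kappa> h0 in \<open>auto simp: node_def\<close>)
    finally show "\<bar>F v i - F w i\<bar> \<le> D' * h" by (simp add: D'_def mult.assoc)
  qed (use e H in auto)
  have "\<bar>step v s - R g (G (step v)) s\<bar> \<le> e" if s: "- real n \<le> s" "s < real n" for s
  proof -
    define y where "y = node (cell s)"
    have "C y * \<bar>F v (cell s) - v (cell s)\<bar> \<le> H * (e / (2 * H))"
      using C(2) H fix_v[OF cell(1)[OF s]] by (intro mult_mono) auto
    then have 1: "C y * \<bar>F v (cell s) - v (cell s)\<bar> \<le> e / 2" using H by simp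
    have "C y * (F v (cell s) - v (cell s)) = R g (G (step v)) y - step v s"
      using C(1)[of y] s by (simp add: F_def step_def y_def field_simps)
    then have 2: "\<bar>R g (G (step v)) y - step v s\<bar> \<le> e / 2"
      using 1 less_imp_le[OF C(1), of y] by (metis abs_mult abs_of_nonneg)
    have "\<bar>R g (G (step v)) s - R g (G (step v)) y\<bar> \<le> E * \<bar>s - y\<bar>"
      unfolding E_def by (intro R_lip admissible_profile admissible v g_lip)
    also have "\<dots> \<le> E * (1 / N)" using cell[OF s] E by (intro mult_left_mono) (auto simp: y_def)
    finally show ?thesis using 2 NE by linarith
  qed
  then show thesis using that[of "step v"] admissible[OF v] step_range(3)[OF v] by (auto simp: A_def)
qed

text \<open>Window and tolerance both depend on \<open>n\<close>: every \<open>s\<close> eventually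
  lies in the window, so the residual tends to 0 pointwise and \<open>compactness\<close>
  applies.\<close>

lemma solution_with_source:
  assumes g: "\<And>s. 0 \<le> g s" "\<And>s. g s \<le> \<alpha> * \<beta> * \<kappa>" "\<And>s. g s \<le> (\<alpha> + l) * (\<beta> - l) * exp (l * s)"
    and g_lip: "\<And>s t. \<bar>g s - g t\<bar> \<le> D\<^sub>g * \<bar>s - t\<bar>"
  obtains \<phi> where "profile \<phi>" "admissible (R g \<phi>)" "\<phi> = G (R g \<phi>)" "\<And>x. \<phi> x \<le> exp (l * x)"
proof -
  have "\<exists>f. admissible f \<and> (\<forall>s. f s \<le> (\<alpha> + l) * (\<beta> - l) * exp (l * s)) \<and>
      (\<forall>s. - real n \<le> s \<longrightarrow> s < real n \<longrightarrow> \<bar>f s - R g (G f) s\<bar> \<le> inverse (real (Suc n)))" for n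
    by (rule approximate_solution[OF g g_lip, of "inverse (real (Suc n))" n]) auto
  then obtain f where f: "\<And>n. admissible (f n)" "\<And>n s. f n s \<le> (\<alpha> + l) * (\<beta> - l) * exp (l * s)"
    and near: "\<And>n s. - real n \<le> s \<Longrightarrow> s < real n \<Longrightarrow> \<bar>f n s - R g (G (f n)) s\<bar> \<le> inverse (real (Suc n))"
    by metis
  have "(\<lambda>n. f n s - R g (G (f n)) s) \<longlonglongrightarrow> 0" for s
  proof (rule Lim_null_comparison[OF _ LIMSEQ_inverse_real_of_nat])
    show "\<forall>\<^sub>F n in sequentially. norm (f n s - R g (G (f n)) s) \<le> inverse (real (Suc n))"
      using eventually_gt_at_top[of "nat \<lceil>\<bar>s\<bar>\<rceil>"]
    proof eventually_elim
      case (elim n)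
      then have "\<bar>s\<bar> < real n" by linarith
      then show ?case using near[of n s] by auto
    qed
  qed
  from compactness[OF f(1) g(1,2) this] obtain r \<phi> where
    *: "strict_mono (r :: nat \<Rightarrow> nat)" "\<And>x. (\<lambda>n. G (f (r n)) x) \<longlonglongrightarrow> \<phi> x"
    "profile \<phi>" "admissible (R g \<phi>)" "\<phi> = G (R g \<phi>)" by blast
  have "\<phi> x \<le> exp (l * x)" for x
    using G_le_supersolution[OF f] by (intro LIMSEQ_le_const2[OF *(2)]) auto
  with that * show thesis by blast
qed

section \<open>Persistence near \<open>+\<infinity>\<close> and removal of the source\<close>

text \<open>A bootstrap on the limes inferior \<open>I\<close>: if \<open>I < k\<close>, then
  \<open>b\<close> exceeds \<open>\<alpha> * \<beta> * I\<close> by a fixed margin on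
  \<open>[I - \<epsilon>, \<kappa>]\<close>, hence so does \<open>f\<close> far to the right, and
  \<open>G f\<close> eventually stays above a number larger than \<open>I\<close>. The bound
  \<open>a > 0\<close> excludes \<open>I = 0\<close>. Asking only for an inequality on
  \<open>f\<close> covers the problems with and without source.\<close>

lemma eventually_ge_below:
  assumes admissible: "admissible f" and ge: "\<And>s. f s \<ge> b (delayed (G f) s)"
    and k: "k \<le> \<kappa>" "\<And>u v. 0 < v \<Longrightarrow> v < k \<Longrightarrow> u \<in> {v..\<kappa>} \<Longrightarrow> \<alpha> * \<beta> * v < b u"
    and a: "a > 0" "eventually (\<lambda>x. G f x \<ge> a) at_top" and v: "v < k"
  shows "eventually (\<lambda>x. G f x \<ge> v) at_top"
proof -
  \<comment> \<open>The eventual lower bounds; their supremum is the limes inferior as a real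
    number.\<close>
  define S where "S = {v. eventually (\<lambda>x. G f x \<ge> v) at_top}"
  have profile: "profile (G f)" by (rule admissible_profile[OF admissible])
  have aS: "a \<in> S" using a by (simp add: S_def)
  have "v \<le> \<kappa>" if "v \<in> S" for v
  proof -
    obtain x where "v \<le> G f x"
      using eventually_happens'[OF trivial_limit_at_top_linorder, of "\<lambda>x. G f x \<ge> v"] \<open>v \<in> S\<close> by (auto simp: S_def)
    then show ?thesis using profile_range(1)[OF profile, of x] by auto
  qed
  then have bdd: "bdd_above S" by (rule bdd_aboveI)
  define I where "I = Sup S"
  have I: "a \<le> I" unfolding I_def by (rule cSup_upper[OF aS bdd])
  have "k \<le> I"
  proof (rule ccontr)
    assume "\<not> k \<le> I"
    then have Ik: "I < k" by simp
    have "continuous_on {0..\<kappa>} b"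
      by (rule lipschitz_on_continuous_on[of D\<^sub>b]) (auto simp: lipschitz_on_def b_lip D\<^sub>b_nonneg dist_real_def)
    then have "continuous_on {I..\<kappa>} b" by (rule continuous_on_subset) (use a I in auto)
    moreover have "{I..\<kappa>} \<noteq> {}" using Ik k by simp
    ultimately obtain u where u: "u \<in> {I..\<kappa>}" "\<And>w. w \<in> {I..\<kappa>} \<Longrightarrow> b u \<le> b w"
      using continuous_attains_inf[of "{I..\<kappa>}" b] by auto
    have bu: "\<alpha> * \<beta> * I < b u" using k(2)[OF _ Ik u(1)] a I by simp
    \<comment> \<open>The first bound keeps \<open>I - \<epsilon>\<close> positive; the second keeps
      the loss \<open>D\<^sub>b * \<epsilon>\<close> below the margin.\<close>
    define \<epsilon> where "\<epsilon> = min (I / 2) ((b u - \<alpha> * \<beta> * I) / (2 * (D\<^sub>b + 1)))"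
    have \<epsilon>: "0 < \<epsilon>" "\<epsilon> < I" using bu a I D\<^sub>b_nonneg by (auto simp: \<epsilon>_def min_less_iff_disj)
    have "D\<^sub>b * \<epsilon> \<le> D\<^sub>b * ((b u - \<alpha> * \<beta> * I) / (2 * (D\<^sub>b + 1)))"
      using D\<^sub>b_nonneg by (intro mult_left_mono) (auto simp: \<epsilon>_def)
    also have "\<dots> < b u - \<alpha> * \<beta> * I"
    proof -
      have "0 < (b u - \<alpha> * \<beta> * I) * (D\<^sub>b + 2)" using bu D\<^sub>b_nonneg by simp
      then show ?thesis using D\<^sub>b_nonneg by (simp add: divide_simps) (simp add: algebra_simps)
    qed
    finally have gap: "\<alpha> * \<beta> * I < b u - D\<^sub>b * \<epsilon>" by simp
    have b_ge': "b u - D\<^sub>b * \<epsilon> \<le> b w" if w: "w \<in> {I - \<epsilon>..\<kappa>}" for w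
    proof (cases "w \<ge> I")
      case True
      then show ?thesis using u(2)[of w] w \<epsilon> D\<^sub>b_nonneg by (auto intro: order.trans[rotated])
    next
      case False
      have "\<bar>b w - b I\<bar> \<le> D\<^sub>b * \<bar>w - I\<bar>" using w \<epsilon> False Ik k by (intro b_lip) auto
      also have "\<dots> \<le> D\<^sub>b * \<epsilon>" using D\<^sub>b_nonneg w False by (intro mult_left_mono) auto
      finally show ?thesis using u(2)[of I] Ik k by auto
    qed
    obtain w where "w \<in> S" "I - \<epsilon> < w"
      using less_cSup_iff[OF _ bdd, of "I - \<epsilon>"] aS \<epsilon> by (auto simp: I_def)
    then obtain X where X: "\<And>x. x \<ge> X \<Longrightarrow> I - \<epsilon> \<le> G f x"
      unfolding S_def eventually_at_top_linorder by fastforce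
    \<comment> \<open>Past \<open>X'\<close> the delayed argument is still at least
      \<open>X\<close>, because \<open>\<tau>\<close> is 1-Lipschitz and profiles do not exceed
      \<open>\<kappa>\<close>.\<close>
    define X' where "X' = X + c * (\<tau> 0 + \<kappa>)"
    have "b u - D\<^sub>b * \<epsilon> \<le> f s" if "s \<ge> X'" for s
    proof -
      have "\<tau> (G f s) \<le> \<tau> 0 + \<kappa>"
        using \<tau>_lip[of "G f s" 0] profile_range(1)[OF profile, of s] by auto
      then have "c * \<tau> (G f s) \<le> c * (\<tau> 0 + \<kappa>)" using c by (rule mult_left_mono)
      then have "I - \<epsilon> \<le> delayed (G f) s" unfolding delayed_def using that by (intro X) (simp add: X'_def)
      then show ?thesis using b_ge'[of "delayed (G f) s"] delayed_range[OF profile, of s] ge[of s] by auto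
    qed
    moreover have pos: "0 < \<alpha> * \<beta> * I" using \<alpha> \<beta> a I by simp
    have "I < (b u - D\<^sub>b * \<epsilon>) / (\<alpha> * \<beta>)" using gap \<alpha> \<beta> by (simp add: field_simps)
    then obtain v' where v': "I < v'" "v' < (b u - D\<^sub>b * \<epsilon>) / (\<alpha> * \<beta>)" using dense by blast
    ultimately have "v' \<in> S"
      unfolding S_def using admissible gap pos by (auto simp: admissible_def intro!: G_eventually_ge[where a = "b u - D\<^sub>b * \<epsilon>" and X = X'])
    then have "v' \<le> I" unfolding I_def using bdd by (rule cSup_upper)
    with v' show False by simp
  qed
  then have "v < Sup S" using v by (simp add: I_def)
  then obtain w where "w \<in> S" "v < w" using less_cSup_iff[OF _ bdd] aS by auto
  then show ?thesis unfolding S_def by (auto elim: eventually_mono)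
qed

text \<open>The crossing is the supremum of the closed set where \<open>\<phi> x \<le> a\<close>;
  the exponential bound makes this set nonempty, and the eventual lower bound makes it bounded
  above.\<close>

lemma last_crossing:
  assumes \<phi>: "profile \<phi>" and le: "\<And>x. \<phi> x \<le> exp (l * x)" and a: "0 < a" "a < v"
    and ev: "eventually (\<lambda>x. \<phi> x \<ge> v) at_top"
  obtains \<xi> where "\<phi> \<xi> = a" "\<And>x. x \<ge> \<xi> \<Longrightarrow> \<phi> x \<ge> a"
proof -
  define S where "S = {x. \<phi> x \<le> a}"
  obtain X where X: "\<And>x. x \<ge> X \<Longrightarrow> \<phi> x \<ge> v" using ev by (auto simp: eventually_at_top_linorder)
  have bdd: "bdd_above S"
  proof (rule bdd_aboveI)
    fix x assume "x \<in> S"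
    then show "x \<le> X" using X[of x] a by (cases "x \<le> X") (auto simp: S_def)
  qed
  have "\<phi> (ln a / l) \<le> a" using le[of "ln a / l"] a l by simp
  then have ne: "S \<noteq> {}" by (auto simp: S_def)
  have "closed S"
    unfolding S_def by (intro closed_Collect_le profile_continuous[OF \<phi>] continuous_on_const)
  from closed_contains_Sup[OF ne bdd this] have le_a: "\<phi> (Sup S) \<le> a" by (simp add: S_def)
  have gt: "\<phi> x > a" if "x > Sup S" for x
    using that cSup_upper[OF _ bdd, of x] by (force simp: S_def)
  have "isCont \<phi> (Sup S)" using profile_continuous[OF \<phi>] by (simp add: continuous_on_eq_continuous_at)
  then have "(\<phi> \<longlongrightarrow> \<phi> (Sup S)) (at_right (Sup S))"
    by (auto simp: isCont_def intro: tendsto_mono[rotated] at_le)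
  moreover have "eventually (\<lambda>x. a \<le> \<phi> x) (at_right (Sup S))"
    using eventually_at_right_less[of "Sup S"] by eventually_elim (use gt in \<open>auto intro: less_imp_le\<close>)
  ultimately have "a \<le> \<phi> (Sup S)" by (rule tendsto_lowerbound) simp
  with le_a gt show thesis by (intro that[of "Sup S"]) (force simp: le_less)+
qed

text \<open>Normalising at the last crossing keeps the limit away from zero: the value at 0 is
  fixed, and the bound on the right half-line is the initial bound that
  \<open>eventually_ge_below\<close> asks for.\<close>

lemma persistent_solution:
  assumes k: "0 < k" "k \<le> \<kappa>" "\<And>u v. 0 < v \<Longrightarrow> v < k \<Longrightarrow> u \<in> {v..\<kappa>} \<Longrightarrow> \<alpha> * \<beta> * v < b u"
    and a: "0 < a" "a < k"
  obtains \<phi> where "profile \<phi>" "admissible (R (\<lambda>_. 0) \<phi>)" "\<phi> = G (R (\<lambda>_. 0) \<phi>)" "\<phi> 0 = a" "\<And>x. x \<ge> 0 \<Longrightarrow> \<phi> x \<ge> a"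
proof -
  define A where "A = (\<alpha> + l) * (\<beta> - l)"
  define H where "H = \<alpha> * \<beta> * \<kappa>"
  \<comment> \<open>The factor \<open>min A H\<close> lets the source respect both the exponential
    and the constant bound for every \<open>n\<close>.\<close>
  define \<delta> where "\<delta> = (\<lambda>n. min A H * inverse (real (Suc n)))"
  have "A > 0" "H > 0" using \<alpha> \<beta> l \<kappa> by (auto simp: A_def H_def)
  then have min: "min A H > 0" by simp
  have \<delta>: "0 < \<delta> n" "\<delta> n \<le> A" "\<delta> n \<le> H" for n
  proof -
    show "0 < \<delta> n" using min by (simp add: \<delta>_def)
    have "\<delta> n \<le> min A H * 1" unfolding \<delta>_def using min by (intro mult_left_mono) (auto simp: field_simps)
    then show "\<delta> n \<le> A" "\<delta> n \<le> H" by auto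
  qed
  \<comment> \<open>Exponential to the left, to stay under the supersolution; constant to the right,
    to be bounded away from zero near \<open>+\<infinity>\<close>.\<close>
  define g where "g = (\<lambda>n s. \<delta> n * exp (l * min s 0))"
  have g: "0 \<le> g n s" "g n s \<le> \<delta> n" "g n s \<le> A * exp (l * s)" for n s
  proof -
    show "0 \<le> g n s" using \<delta>[of n] by (simp add: g_def)
    have "exp (l * min s 0) \<le> 1" using l by (simp add: mult_nonneg_nonpos)
    from mult_left_mono[OF this less_imp_le[OF \<delta>(1)[of n]]] show "g n s \<le> \<delta> n" by (simp add: g_def)
    show "g n s \<le> A * exp (l * s)" unfolding g_def using \<delta>[of n] l by (intro mult_mono) auto
  qed
  have g_lip: "\<bar>g n s - g n t\<bar> \<le> (\<delta> n * l) * \<bar>s - t\<bar>" for n s t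
  proof -
    have "\<bar>exp (l * min s 0) - exp (l * min t 0)\<bar> \<le> \<bar>l * min s 0 - l * min t 0\<bar>"
      using l by (intro exp_lipschitz_nonpos) (auto simp: mult_nonneg_nonpos)
    also have "\<dots> = l * \<bar>min s 0 - min t 0\<bar>" using l by (simp add: abs_mult flip: right_diff_distrib)
    also have "\<dots> \<le> l * \<bar>s - t\<bar>" using l by (intro mult_left_mono) auto
    finally have "\<delta> n * \<bar>exp (l * min s 0) - exp (l * min t 0)\<bar> \<le> \<delta> n * (l * \<bar>s - t\<bar>)"
      using \<delta>[of n] by (intro mult_left_mono) auto
    then show ?thesis using \<delta>[of n] by (simp add: g_def abs_mult mult.assoc flip: right_diff_distrib)
  qed
  define P where "P = (\<lambda>n \<phi> \<xi>. profile \<phi> \<and> admissible (R (g n) \<phi>) \<and> \<phi> = G (R (g n) \<phi>) \<and> \<phi> \<xi> = a \<and> (\<forall>x\<ge>\<xi>. \<phi> x \<ge> a))"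
  have "\<exists>\<phi> \<xi>. P n \<phi> \<xi>" for n
  proof -
    have H: "g n s \<le> \<alpha> * \<beta> * \<kappa>" for s using g(2)[of n s] \<delta>(3)[of n] by (simp add: H_def)
    obtain \<phi> where \<phi>: "profile \<phi>" "admissible (R (g n) \<phi>)" "\<phi> = G (R (g n) \<phi>)" "\<And>x. \<phi> x \<le> exp (l * x)"
      using solution_with_source[OF g(1) H g(3)[unfolded A_def] g_lip] by blast
    have \<delta>0: "0 < \<delta> n / (2 * (\<alpha> * \<beta>))" using \<delta>[of n] \<alpha> \<beta> by simp
    have "eventually (\<lambda>x. G (R (g n) \<phi>) x \<ge> \<delta> n / (2 * (\<alpha> * \<beta>))) at_top"
    proof (rule G_eventually_ge[where a = "\<delta> n" and X = 0])
      show "\<delta> n / (2 * (\<alpha> * \<beta>)) < \<delta> n / (\<alpha> * \<beta>)" using \<delta>[of n] \<alpha> \<beta> by (simp add: field_simps)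
    qed (use \<phi>(2) \<delta>[of n] in \<open>auto simp: admissible_def R_def g_def\<close>)
    note pos = this
    have ge: "R (g n) \<phi> s \<ge> b (delayed (G (R (g n) \<phi>)) s)" for s
      unfolding \<phi>(3)[symmetric] by (simp add: R_def)
    \<comment> \<open>An intermediate level is taken: \<open>last_crossing\<close> needs one
      strictly above \<open>a\<close>, and \<open>eventually_ge_below\<close> reaches only levels
      strictly below \<open>k\<close>.\<close>
    have ak: "a < (a + k) / 2" "(a + k) / 2 < k" using a by simp_all
    have "eventually (\<lambda>x. G (R (g n) \<phi>) x \<ge> (a + k) / 2) at_top"
      by (rule eventually_ge_below[OF \<phi>(2) ge k(2,3) \<delta>0 pos ak(2)])
    then have "eventually (\<lambda>x. \<phi> x \<ge> (a + k) / 2) at_top" unfolding \<phi>(3)[symmetric] .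
    from last_crossing[OF \<phi>(1,4) a(1) ak(1) this] obtain \<xi> where "\<phi> \<xi> = a" "\<And>x. x \<ge> \<xi> \<Longrightarrow> \<phi> x \<ge> a" by blast
    with \<phi> show ?thesis unfolding P_def by blast
  qed
  then obtain \<phi> \<xi> where "\<And>n. P n (\<phi> n) (\<xi> n)" by metis
  then have \<phi>: "\<And>n. profile (\<phi> n)" "\<And>n. admissible (R (g n) (\<phi> n))" "\<And>n. \<phi> n = G (R (g n) (\<phi> n))"
    and \<xi>: "\<And>n. \<phi> n (\<xi> n) = a" "\<And>n x. x \<ge> \<xi> n \<Longrightarrow> \<phi> n x \<ge> a"
    unfolding P_def by blast+
  \<comment> \<open>The right-hand sides are translated, since \<open>G\<close> commutes with
    translations. Dropping the translated source costs at most \<open>\<delta> n\<close>, wherever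
    the crossing lies.\<close>
  define f where "f = (\<lambda>n s. R (g n) (\<phi> n) (s + \<xi> n))"
  have f: "admissible (f n)" for n
    using \<phi>(2)[of n] unfolding f_def admissible_def by auto
  have Gf: "G (f n) x = \<phi> n (x + \<xi> n)" for n x
    unfolding f_def G_shift by (simp flip: \<phi>(3))
  have near: "norm (f n s - R (\<lambda>_. 0) (G (f n)) s) \<le> \<delta> n" for n s
  proof -
    have "delayed (G (f n)) s = delayed (\<phi> n) (s + \<xi> n)" by (simp add: delayed_def Gf algebra_simps)
    then show ?thesis
      using max_dist[of "b (delayed (\<phi> n) (s + \<xi> n))" "g n (s + \<xi> n)" "b (delayed (\<phi> n) (s + \<xi> n))" 0]
        g[of n "s + \<xi> n"] by (simp add: f_def R_def)
  qed
  have "\<delta> \<longlonglongrightarrow> 0"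
    unfolding \<delta>_def by (intro tendsto_mult_right_zero LIMSEQ_inverse_real_of_nat)
  then have lim: "(\<lambda>n. f n s - R (\<lambda>_. 0) (G (f n)) s) \<longlonglongrightarrow> 0" for s
    by (rule Lim_null_comparison[OF always_eventually[OF allI[OF near]]])
  have "0 \<le> \<alpha> * \<beta> * \<kappa>" using \<open>H > 0\<close> by (simp add: H_def)
  from compactness[OF f order_refl this lim] obtain r \<psi> where
    r: "strict_mono (r :: nat \<Rightarrow> nat)" "\<And>x. (\<lambda>n. G (f (r n)) x) \<longlonglongrightarrow> \<psi> x"
    and \<psi>: "profile \<psi>" "admissible (R (\<lambda>_. 0) \<psi>)" "\<psi> = G (R (\<lambda>_. 0) \<psi>)" by blast
  have "\<psi> 0 = a" using r(2)[of 0] \<xi>(1) by (simp add: Gf LIMSEQ_const_iff)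
  moreover have "\<psi> x \<ge> a" if "x \<ge> 0" for x
    using that \<xi>(2) by (intro LIMSEQ_le_const[OF r(2)]) (auto simp: Gf)
  ultimately show thesis using that \<psi> by blast
qed

end

section \<open>An exponent at the critical speed\<close>

text \<open>The definition of the critical speed says nothing at \<open>cs\<close> itself, so
  exponents between the two roots are taken at speeds decreasing to \<open>cs\<close>. They are
  bounded, and by continuity a limit point has \<open>Lam \<le> 0\<close>; it is not 0, because
  \<open>Lam\<close> at 0 is \<open>p - d > 0\<close>.\<close>

lemma critical_exponent:
  assumes crit: "is_critical_speed d p m cs" and "d > 0" "p > d"
  obtains l where "l > 0" "Lam d p m l cs \<le> 0"
proof -
  define cn where "cn = (\<lambda>n. cs + inverse (real (Suc n)))"
  have "\<exists>l>0. Lam d p m l (cn n) \<le> 0" for n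
  proof -
    have "cn n > cs" by (simp add: cn_def)
    then obtain l1 l2 where l: "0 < l1" "l1 < l2" "\<forall>l\<in>{l1<..<l2}. Lam d p m l (cn n) < 0"
      using crit unfolding is_critical_speed_def by blast
    then have "(l1 + l2) / 2 > 0 \<and> Lam d p m ((l1 + l2) / 2) (cn n) \<le> 0"
      by (auto intro!: less_imp_le)
    then show ?thesis by blast
  qed
  then obtain l where l: "\<And>n. l n > 0" "\<And>n. Lam d p m (l n) (cn n) \<le> 0" by metis
  have cs: "cs > 0" using crit by (simp add: is_critical_speed_def)
  \<comment> \<open>Beyond this bound, \<open>cn n \<le> cs + 1\<close> makes the square exceed
    \<open>cn n * l n + d\<close>, and \<open>Lam\<close> would be positive.\<close>
  have bound: "l n \<le> cs + 2 + d" for n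
  proof (rule ccontr)
    assume "\<not> l n \<le> cs + 2 + d"
    then have big: "l n > cs + 2 + d" by simp
    have "cn n \<le> cs + 1" by (simp add: cn_def inverse_le_1_iff)
    then have "cn n * l n \<le> (cs + 1) * l n" using l(1)[of n] by (intro mult_right_mono) auto
    moreover have "(cs + 2 + d) * l n \<le> l n * l n" using big l(1)[of n] by (intro mult_right_mono) auto
    moreover have "d * 1 \<le> d * l n" using big cs \<open>d > 0\<close> by (intro mult_left_mono) auto
    moreover have "p * exp (- (l n * cn n * m)) > 0" using \<open>p > d\<close> \<open>d > 0\<close> by simp
    ultimately have "Lam d p m (l n) (cn n) > 0"
      using l(1)[of n] by (simp add: Lam_def power2_eq_square algebra_simps)
    then show False using l(2)[of n] by simp
  qed
  obtain L r where r: "strict_mono (r :: nat \<Rightarrow> nat)" and L: "L \<in> {0..cs + 2 + d}" "(l \<circ> r) \<longlonglongrightarrow> L"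
  proof -
    have "compact {0..cs + 2 + d}" by (rule compact_Icc)
    moreover have "\<forall>n. l n \<in> {0..cs + 2 + d}" using bound l(1) by (simp add: less_imp_le)
    ultimately show thesis unfolding compact_def using that by blast
  qed
  have "cn \<longlonglongrightarrow> cs + 0" unfolding cn_def by (intro tendsto_intros LIMSEQ_inverse_real_of_nat)
  from LIMSEQ_subseq_LIMSEQ[OF this r] have "(\<lambda>n. cn (r n)) \<longlonglongrightarrow> cs" by (simp add: o_def)
  then have "(\<lambda>n. Lam d p m (l (r n)) (cn (r n))) \<longlonglongrightarrow> Lam d p m L cs"
    unfolding Lam_def using L(2) by (auto simp: o_def intro!: tendsto_intros)
  then have "Lam d p m L cs \<le> 0" by (rule LIMSEQ_le_const2) (use l(2) in auto)
  moreover from this have "L \<noteq> 0" using \<open>p > d\<close> by (auto simp: Lam_def)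
  ultimately show thesis using that[of L] L(1) by auto
qed

section \<open>The critical wave\<close>

theorem theorem3p4:
  fixes d K L m M k c c_star :: real
    and b b' \<tau> \<tau>' :: "real \<Rightarrow> real"
  assumes d_pos: "d > 0"
    and K_pos: "K > 0"
    and b_nonneg: "\<And>u. u \<ge> 0 \<Longrightarrow> b u \<ge> 0"
    and b_0: "b 0 = 0"
    and b_K: "b K = d * K"
    and b_below_K: "\<And>u. 0 < u \<Longrightarrow> u < K \<Longrightarrow> b u > d * u"
    and b_above_K: "\<And>u. u > K \<Longrightarrow> 0 < b u \<and> b u < d * u"
    and tau_nonneg: "\<And>u. u \<ge> 0 \<Longrightarrow> \<tau> u \<ge> 0"
    and tau_deriv: "\<And>u. u \<ge> 0 \<Longrightarrow> (\<tau> has_real_derivative \<tau>' u) (at u within {0..})"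
    and tau_C1: "continuous_on {0..} \<tau>'"
    and tau'_bounds: "\<And>u. u \<ge> 0 \<Longrightarrow> 0 \<le> \<tau>' u \<and> \<tau>' u < 1"
    and m_def: "m = \<tau> 0"
    and M_lim: "(\<tau> \<longlongrightarrow> M) at_top"
    and m_M: "0 \<le> m" "m \<le> M"
    and b_deriv: "\<And>u. u \<ge> 0 \<Longrightarrow> (b has_real_derivative b' u) (at u within {0..})"
    and b_C1: "continuous_on {0..} b'"
    and b'_0: "b' 0 > d"
    and b_sublinear: "\<And>u. u > 0 \<Longrightarrow> b u < b' 0 * u"
    and b'_bound: "\<And>u. u \<in> {0..K} \<Longrightarrow> \<bar>b' u\<bar> \<le> b' 0"
    and L_pos: "L > 0"
    and L_bound: "\<And>u. u \<in> {0<..K} \<Longrightarrow> 0 \<le> b' 0 * u - b u \<and> b' 0 * u - b u < L * u\<^sup>2"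
    and k_pos: "0 < k"
    and k_le: "k \<le> K"
    and k_eq: "b_low d b K k = d * k"
    and c_star: "is_critical_speed d (b' 0) m c_star"
    and c_eq: "c = c_star"
  shows "\<exists>\<phi> \<phi>' \<phi>'' :: real \<Rightarrow> real.
    (\<forall>\<xi>. (\<phi> has_real_derivative \<phi>' \<xi>) (at \<xi>)) \<and>
    (\<forall>\<xi>. (\<phi>' has_real_derivative \<phi>'' \<xi>) (at \<xi>)) \<and>
    continuous_on UNIV \<phi>'' \<and>
    (\<forall>\<xi>. \<phi> \<xi> > 0) \<and>
    \<not> \<phi> constant_on UNIV \<and>
    (\<forall>\<xi>. \<phi>'' \<xi> - c * \<phi>' \<xi> - d * \<phi> \<xi> + b (\<phi> (\<xi> - c * \<tau> (\<phi> \<xi>))) = 0) \<and>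
    ereal k \<le> Liminf at_top (\<lambda>\<xi>. ereal (\<phi> \<xi>)) \<and>
    Liminf at_top (\<lambda>\<xi>. ereal (\<phi> \<xi>)) \<le> Limsup at_top (\<lambda>\<xi>. ereal (\<phi> \<xi>)) \<and>
    Limsup at_top (\<lambda>\<xi>. ereal (\<phi> \<xi>)) \<le> ereal (calK d b K)"
proof -
  define \<kappa> where "\<kappa> = calK d b K"
  \<comment> \<open>\<open>q\<close> is the square root of the discriminant of
    \<open>r\<^sup>2 - c r - d\<close>, whose roots are \<open>- \<alpha>\<close> and
    \<open>\<beta>\<close>.\<close>
  define q where "q = sqrt (c\<^sup>2 + 4 * d)"
  define \<alpha> where "\<alpha> = (q - c) / 2"
  define \<beta> where "\<beta> = (q + c) / 2"
  have c_pos: "c > 0" using c_star by (simp add: c_eq is_critical_speed_def)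
  have "c < q" unfolding q_def using d_pos by (intro real_less_rsqrt) simp
  then have \<alpha>: "\<alpha> > 0" and \<beta>: "\<beta> > 0" using c_pos by (auto simp: \<alpha>_def \<beta>_def)
  have \<alpha>\<beta>: "\<beta> - \<alpha> = c" "\<alpha> * \<beta> = d"
  proof -
    have "q * q = c * c + 4 * d" using d_pos by (simp add: q_def power2_eq_square)
    then show "\<alpha> * \<beta> = d" by (simp add: \<alpha>_def \<beta>_def algebra_simps)
  qed (simp add: \<alpha>_def \<beta>_def field_simps)
  have p: "b' 0 > 0" using b'_0 d_pos by simp
  obtain l where l: "l > 0" "Lam d (b' 0) m l c \<le> 0"
    using critical_exponent[OF c_star d_pos b'_0] unfolding c_eq by blast
  have factor: "(\<alpha> + l) * (\<beta> - l) = d + c * l - l\<^sup>2"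
    by (simp add: \<alpha>\<beta>[symmetric] power2_eq_square algebra_simps)
  have super: "b' 0 * exp (- (l * c * m)) \<le> (\<alpha> + l) * (\<beta> - l)"
    unfolding factor using l(2) by (simp add: Lam_def)
  \<comment> \<open>The positive left side of \<open>super\<close> forces
    \<open>l < \<beta>\<close>, the condition under which \<open>G\<close> acts on
    \<open>exp (l * x)\<close>.\<close>
  then have "0 < (\<alpha> + l) * (\<beta> - l)" using p by (smt (verit) exp_gt_zero mult_pos_pos)
  then have l\<beta>: "l < \<beta>" using \<alpha> l by (simp add: zero_less_mult_iff)

  have b_cont: "continuous_on {0..} b"
    by (rule DERIV_continuous_on) (use b_deriv in auto)
  have b_compact: "compact (b ` {u..v})" if "u \<ge> 0" for u v
    using that by (intro compact_continuous_image continuous_on_subset[OF b_cont]) auto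
  have b_le_K: "b u \<le> d * \<kappa>" if "u \<in> {0..K}" for u
  proof -
    have "b u \<le> (SUP u\<in>{0..K}. b u)"
      using that by (intro cSUP_upper bounded_imp_bdd_above compact_imp_bounded b_compact) auto
    then show ?thesis using d_pos by (simp add: \<kappa>_def calK_def)
  qed
  have K\<kappa>: "K \<le> \<kappa>" using b_le_K[of K] b_K K_pos d_pos by simp
  have b_le: "b u \<le> d * \<kappa>" if "u \<in> {0..\<kappa>}" for u
  proof (cases "u \<le> K")
    case False
    then have "b u < d * u" using b_above_K[of u] by simp
    also have "\<dots> \<le> d * \<kappa>" using that d_pos by simp
    finally show ?thesis by simp
  qed (use that b_le_K in auto)
  \<comment> \<open>Below \<open>k\<close> this follows from \<open>b u > d u\<close>, since
    \<open>k \<le> K\<close>; from \<open>k\<close> on, \<open>b_low\<close> at \<open>k\<close>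
    gives \<open>b u \<ge> d k > d v\<close>.\<close>
  have b_above: "d * v < b u" if "0 < v" "v < k" "u \<in> {v..\<kappa>}" for u v
  proof (cases "u < k")
    case True
    then have "d * v \<le> d * u" using that d_pos by simp
    also have "\<dots> < b u" using that True k_le by (intro b_below_K) auto
    finally show ?thesis .
  next
    case False
    have "d * v < d * k" using that d_pos by simp
    also have "\<dots> = (INF v\<in>{k..\<kappa>}. b v)" using k_eq by (simp add: b_low_def \<kappa>_def)
    also have "\<dots> \<le> b u"
      using that False k_pos
      by (intro cINF_lower bounded_imp_bdd_below compact_imp_bounded b_compact) auto
    finally show ?thesis .
  qed
  obtain D\<^sub>b where D\<^sub>b: "\<And>u. u \<in> {0..\<kappa>} \<Longrightarrow> norm (b' u) \<le> D\<^sub>b"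
  proof -
    have "compact (b' ` {0..\<kappa>})"
      by (intro compact_continuous_image continuous_on_subset[OF b_C1]) auto
    from compact_imp_bounded[OF this] obtain B where "\<forall>u\<in>{0..\<kappa>}. norm (b' u) \<le> B"
      by (auto simp: bounded_iff)
    then show thesis by (intro that) auto
  qed
  have b_lip: "\<bar>b u - b v\<bar> \<le> D\<^sub>b * \<bar>u - v\<bar>" if "u \<in> {0..\<kappa>}" "v \<in> {0..\<kappa>}" for u v
    using field_differentiable_bound[of "{0..\<kappa>}" b b' D\<^sub>b u v] that D\<^sub>b
      has_field_derivative_subset[OF b_deriv, of _ "{0..\<kappa>}"] by auto
  have \<tau>_lip: "\<bar>\<tau> u - \<tau> v\<bar> \<le> \<bar>u - v\<bar>" if "u \<ge> 0" "v \<ge> 0" for u v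
    using field_differentiable_bound[of "{0..}" \<tau> \<tau>' 1 u v] that tau_deriv tau'_bounds by force
  have \<tau>_ge: "m \<le> \<tau> u" if "u \<ge> 0" for u
  proof (cases "u = 0")
    case False
    have "\<tau> 0 \<le> \<tau> u"
    proof (rule DERIV_nonneg_imp_increasing_open[where f = \<tau>])
      show "0 \<le> u" by fact
      show "\<exists>y. (\<tau> has_real_derivative y) (at x) \<and> 0 \<le> y" if "0 < x" "x < u" for x
      proof -
        \<comment> \<open>Passing to the open half-line turns the derivative within
          \<open>{0..}\<close> into a two-sided one.\<close>
        have "(\<tau> has_real_derivative \<tau>' x) (at x within {0<..})"
          using that by (intro has_field_derivative_subset[OF tau_deriv]) auto
        then have "(\<tau> has_real_derivative \<tau>' x) (at x)"
          using that by (subst (asm) at_within_open) auto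
        then show ?thesis using tau'_bounds[of x] that by auto
      qed
      show "continuous_on {0..u} \<tau>"
        by (rule continuous_on_subset[OF DERIV_continuous_on[of "{0..}" \<tau> \<tau>']]) (use tau_deriv in auto)
    qed
    then show ?thesis by (simp add: m_def)
  qed (simp add: m_def)
  interpret delay_wave \<alpha> \<beta> b \<tau> c "b' 0" m l \<kappa> D\<^sub>b
  proof
    show "b u \<le> b' 0 * u" if "u \<in> {0..\<kappa>}" for u
      using that b_sublinear[of u] b_0 by (cases "u = 0") auto
  qed (use \<alpha> \<beta> K_pos K\<kappa> c_pos l l\<beta> b_lip b_nonneg b_le \<tau>_lip \<tau>_ge p super in \<open>auto simp: \<alpha>\<beta>\<close>)

  define f where "f = R (\<lambda>_. 0)"
  obtain \<phi> where profile: "profile \<phi>" and admissible: "admissible (f \<phi>)" and fp: "\<phi> = G (f \<phi>)"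
    and \<phi>_0: "\<phi> 0 = k / 2" and \<phi>_ge: "\<And>x. x \<ge> 0 \<Longrightarrow> \<phi> x \<ge> k / 2"
  proof -
    have "0 < k / 2" "k / 2 < k" using k_pos by simp_all
    from persistent_solution[OF k_pos order.trans[OF k_le K\<kappa>] _ this] b_above show thesis
      using that unfolding f_def \<alpha>\<beta>(2) by blast
  qed
  define F where "F = f \<phi>"
  have F: "F s = b (\<phi> (s - c * \<tau> (\<phi> s)))" for s
    using b_ge[OF delayed_range[OF profile], of s] by (simp add: F_def f_def R_def delayed_def)
  have GF: "G F = \<phi>" unfolding F_def by (rule fp[symmetric])
  have F_admissible: "admissible F" using admissible by (simp add: F_def)
  have F_cont: "continuous_on UNIV F"
  proof (rule lipschitz_on_continuous_on[of "D\<^sub>b * (D * (1 + c * D)) + \<bar>0\<bar>"])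
    show "(D\<^sub>b * (D * (1 + c * D)) + \<bar>0\<bar>)-lipschitz_on UNIV F"
      unfolding lipschitz_on_def dist_real_def F_def f_def
      using R_lip[OF profile, of "\<lambda>_. 0" 0] D\<^sub>b_nonneg D_nonneg c_pos by auto
  qed
  \<comment> \<open>After rewriting with \<open>\<alpha>\<beta>\<close> these are the two
    derivatives of \<open>\<phi>\<close>, and the second one is the profile equation.\<close>
  note deriv = G_deriv[OF F_cont admissible_bound[OF F_admissible], unfolded GF \<alpha>\<beta>]
  define \<phi>'' where "\<phi>'' = (\<lambda>x. c * G' F x + d * \<phi> x - F x)"
  have "continuous_on UNIV (G' F)"
    using deriv(2) by (intro DERIV_continuous_on) (auto intro: has_field_derivative_at_within)
  then have cont: "continuous_on UNIV \<phi>''"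
    unfolding \<phi>''_def by (intro continuous_intros profile_continuous[OF profile] F_cont)
  have pos: "\<phi> x > 0" for x
  proof -
    \<comment> \<open>\<open>b_above\<close> with \<open>v = k / 2\<close> bounds \<open>b\<close>
      below by \<open>\<gamma>\<close> on \<open>[k / 2, \<kappa>]\<close>; far to the right the
      delayed argument is nonnegative, so \<open>F\<close> is at least \<open>\<gamma>\<close>
      there.\<close>
    define \<gamma> where "\<gamma> = d * (k / 2)"
    have \<gamma>: "\<gamma> > 0" "\<And>u. u \<in> {k / 2..\<kappa>} \<Longrightarrow> \<gamma> \<le> b u"
      using b_above[of "k / 2"] k_pos d_pos by (auto simp: \<gamma>_def intro: less_imp_le)
    have "G F x > 0"
    proof (rule G_pos[where a = \<gamma> and X = "c * (\<tau> 0 + \<kappa>)"])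
      fix s assume s: "s \<ge> c * (\<tau> 0 + \<kappa>)"
      have "\<tau> (\<phi> s) \<le> \<tau> 0 + \<kappa>" using \<tau>_lip[of "\<phi> s" 0] profile_range(1)[OF profile, of s] by auto
      then have "c * \<tau> (\<phi> s) \<le> c * (\<tau> 0 + \<kappa>)" using c_pos by simp
      then show "\<gamma> \<le> F s"
        unfolding F using s profile_range(1)[OF profile, of "s - c * \<tau> (\<phi> s)"] \<phi>_ge[of "s - c * \<tau> (\<phi> s)"]
          by (intro \<gamma>) auto
    qed (use F_admissible \<gamma> in \<open>auto simp: admissible_def\<close>)
    then show ?thesis by (simp add: GF)
  qed
  have nonconst: "\<not> \<phi> constant_on UNIV"
  proof
    assume "\<phi> constant_on UNIV"
    then have const: "\<phi> = (\<lambda>_. k / 2)" using \<phi>_0 by (auto simp: constant_on_def)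
    then have "G' F x = 0" for x
      using DERIV_unique[OF deriv(1)[of x], of 0] by simp
    then have "G' F = (\<lambda>_. 0)" by blast
    then have "c * G' F 0 + d * \<phi> 0 - F 0 = 0"
      using DERIV_unique[OF deriv(2)[of 0], of 0] by simp
    then have "d * (k / 2) = b (k / 2)" using \<open>G' F = _\<close> const by (simp add: F)
    then show False using b_below_K[of "k / 2"] k_pos k_le by simp
  qed
  have "eventually (\<lambda>x. \<phi> x \<ge> v) at_top" if "v < k" for v
  proof -
    \<comment> \<open>The bound to the right of the last crossing is the positive starting bound for
      the bootstrap.\<close>
    have ev: "eventually (\<lambda>x. G F x \<ge> k / 2) at_top"
      unfolding GF using \<phi>_ge by (auto simp: eventually_at_top_linorder)
    have "eventually (\<lambda>x. G F x \<ge> v) at_top"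
      by (rule eventually_ge_below[OF F_admissible _ _ _ _ ev that])
         (use k_pos k_le K\<kappa> b_above in \<open>auto simp: GF F delayed_def \<alpha>\<beta>\<close>)
    then show ?thesis by (simp add: GF)
  qed
  note ev = this
  have "ereal k \<le> Liminf at_top (\<lambda>\<xi>. ereal (\<phi> \<xi>))"
    unfolding le_Liminf_iff
  proof (intro allI impI)
    fix y assume y: "y < ereal k"
    then obtain v where v: "y < ereal v" "v < k" using ereal_dense2 by (metis ereal_less(2) less_ereal.simps(1))
    show "\<forall>\<^sub>F x in at_top. y < ereal (\<phi> x)"
      using ev[OF v(2)] by eventually_elim (use v(1) in \<open>auto intro: less_le_trans\<close>)
  qed
  moreover have "Liminf at_top (\<lambda>\<xi>. ereal (\<phi> \<xi>)) \<le> Limsup at_top (\<lambda>\<xi>. ereal (\<phi> \<xi>))"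
    by (rule Liminf_le_Limsup) simp
  moreover have "Limsup at_top (\<lambda>\<xi>. ereal (\<phi> \<xi>)) \<le> ereal (calK d b K)"
    using profile_range(1)[OF profile] by (intro Limsup_bounded always_eventually) (auto simp: \<kappa>_def)
  moreover have "\<phi>'' \<xi> - c * G' F \<xi> - d * \<phi> \<xi> + b (\<phi> (\<xi> - c * \<tau> (\<phi> \<xi>))) = 0" for \<xi>
    by (simp add: \<phi>''_def F)
  moreover have "(G' F has_real_derivative \<phi>'' \<xi>) (at \<xi>)" for \<xi>
    unfolding \<phi>''_def by (rule deriv(2))
  ultimately show ?thesis
    using deriv(1) cont pos nonconst by (intro exI[of _ \<phi>] exI[of _ "G' F"] exI[of _ \<phi>'']) blast
qed

end
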